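(* Let $V$ be a vector space over a field $\mathbb{F}$. Then every endomorphism of $V$ is a linear combination (with coefficients in $\mathbb{F}$) of three idempotent endomorphisms of $V$.
   Context: An endomorphism $e$ is idempotent if $e^2=e$. *)

theory Defs
  imports Complex_Main
begin

definition idempotent_endo :: "('a::field \<Rightarrow> 'b::ab_group_add \<Rightarrow> 'b) \<Rightarrow> ('b \<Rightarrow> 'b) \<Rightarrow> bool" where
  "idempotent_endo scale e \<longleftrightarrow> Vector_Spaces.linear scale scale e \<and> e \<circ> e = e"

end

theory Submission
  imports Defs
begin

text \<open>
  Choose, by Zorn's lemma, a maximal subspace \<open>K\<close> on which \<open>f\<close> is injective and which is independent
  of \<open>f K\<close>, and write \<open>V = K + f K + M\<close>. Maximality forces every vector outside \<open>K + f K\<close> to be an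
  eigenvector modulo \<open>K + f K\<close>, so either \<open>K + f K\<close> is invariant and \<open>f\<close> is a scalar modulo it, or
  \<open>M\<close> is a line.

  Relative to a decomposition \<open>V = K + L\<close>, an endomorphism whose diagonal blocks are suitable scalars is
  a combination of two idempotents, whatever its off-diagonal blocks are. Hence it suffices to find an
  idempotent \<open>Q\<close> and a scalar \<open>\<beta>\<close> such that \<open>f\<close> and \<open>\<beta> Q\<close> have the same diagonal blocks up to scalars.
  The complement \<open>L\<close> can still be sheared, so only the sum of the diagonal blocks on \<open>K\<close> and \<open>f K\<close>,
  that is the endomorphism \<open>S\<close> of \<open>K\<close> with \<open>f (f k) = f (S k)\<close> modulo \<open>K + M\<close>, matters; and \<open>Q\<close>
  built from maps \<open>C, R\<close> contributes a commutator \<open>C R - R C\<close> to it. In infinite dimension every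
  endomorphism of \<open>K\<close> is a commutator with a shift. In finite dimension it is one up to a rank one
  correction, and the coefficients are chosen to satisfy the resulting condition on the trace.
\<close>


section \<open>Linear maps and functionals, and their extension from a basis\<close>

locale endomorphisms = vector_space scale
  for scale :: "'a::field \<Rightarrow> 'b::ab_group_add \<Rightarrow> 'b" (infixr "*s" 75)
begin

abbreviation endo :: "('b \<Rightarrow> 'b) \<Rightarrow> bool" where
  "endo \<equiv> Vector_Spaces.linear scale scale"

abbreviation functional :: "('b \<Rightarrow> 'a) \<Rightarrow> bool" where
  "functional \<equiv> Vector_Spaces.linear scale (*)"

lemma vector_space_field: "vector_space ((*) :: 'a \<Rightarrow> 'a \<Rightarrow> 'a)"
  by unfold_locales (auto simp: algebra_simps)

lemma endo_iff: "endo g \<longleftrightarrow> (\<forall>x y. g (x + y) = g x + g y) \<and> (\<forall>c x. g (c *s x) = c *s g x)"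
  using vector_space_axioms by (auto simp: Vector_Spaces.linear_iff)

lemma functional_iff:
  "functional g \<longleftrightarrow> (\<forall>x y. g (x + y) = g x + g y) \<and> (\<forall>c x. g (c *s x) = c * g x)"
  using vector_space_axioms vector_space_field by (auto simp: Vector_Spaces.linear_iff)

lemma endo_simps:
  assumes "endo g"
  shows "g (x + y) = g x + g y" "g (c *s x) = c *s g x" "g (x - y) = g x - g y"
    "g (- x) = - g x" "g 0 = 0"
proof -
  interpret g: Vector_Spaces.linear scale scale g by fact
  show "g (x + y) = g x + g y" "g (c *s x) = c *s g x" "g (x - y) = g x - g y"
    "g (- x) = - g x" "g 0 = 0"
    by (rule g.add g.scale g.diff g.neg g.zero)+
qed

lemma functional_simps:
  assumes "functional g"
  shows "g (x + y) = g x + g y" "g (c *s x) = c * g x" "g (x - y) = g x - g y"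
    "g (- x) = - g x" "g 0 = 0"
proof -
  interpret g: Vector_Spaces.linear scale "(*)" g by fact
  show "g (x + y) = g x + g y" "g (c *s x) = c * g x" "g (x - y) = g x - g y"
    "g (- x) = - g x" "g 0 = 0"
    by (rule g.add g.scale g.diff g.neg g.zero)+
qed

lemma vector_space_pair_self: "vector_space_pair scale scale"
  by (simp add: vector_space_pair_def vector_space_axioms)

lemma endo_extend:
  assumes "independent B"
  obtains g where "endo g" "\<And>x. x \<in> B \<Longrightarrow> g x = h x" "range g = span (h ` B)"
  using vector_space_pair.linear_independent_extend_subspace[OF vector_space_pair_self assms, of h] by blast

lemma functional_extend:
  assumes "independent B"
  obtains g where "functional g" "\<And>x. x \<in> B \<Longrightarrow> g x = h x"
proof -
  interpret vector_space_pair scale "(*)"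
    by (simp add: vector_space_pair_def vector_space_axioms vector_space_field)
  show ?thesis
    using linear_independent_extend[OF assms, of h] that by blast
qed

lemma endo_eq_on_span:
  assumes "endo g" "endo h" "\<And>x. x \<in> B \<Longrightarrow> g x = h x" "x \<in> span B"
  shows "g x = h x"
  using vector_space_pair.linear_eq_on_span[OF vector_space_pair_self assms(1,2)] assms(3,4) by blast

lemma endo_span_range:
  assumes "endo g" "\<And>x. x \<in> B \<Longrightarrow> g x \<in> span C" "x \<in> span B"
  shows "g x \<in> span C"
proof -
  interpret g: Vector_Spaces.linear scale scale g by fact
  have "g x \<in> span (g ` B)" using g.span_image assms(3) by blast
  also have "\<dots> \<subseteq> span C" using assms(2) by (intro span_minimal) auto
  finally show ?thesis .
qed

section \<open>Combinations of idempotents and their block form\<close>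

definition three_idempotents :: "('b \<Rightarrow> 'b) \<Rightarrow> bool" where
  "three_idempotents f \<longleftrightarrow> (\<exists>(c1::'a) (c2::'a) (c3::'a) e1 e2 e3.
     idempotent_endo scale e1 \<and> idempotent_endo scale e2 \<and> idempotent_endo scale e3 \<and>
     f = (\<lambda>v. scale c1 (e1 v) + scale c2 (e2 v) + scale c3 (e3 v)))"

text \<open>
  \<open>d0\<close> and \<open>d1\<close> are the scalars which \<open>\<alpha> P + \<gamma> E\<close> may have as diagonal blocks for idempotents
  \<open>P\<close>, \<open>E\<close> with arbitrary off-diagonal blocks: \<open>P\<close> has diagonal blocks \<open>0, 1\<close> or \<open>1, 0\<close>, and \<open>E\<close> has
  \<open>0, 1\<close>. Over the field with two elements the only possibilities are \<open>0, 0\<close> and \<open>1, 1\<close>.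
\<close>

definition shifts :: "'a \<Rightarrow> 'a \<Rightarrow> bool" where
  "shifts d0 d1 \<longleftrightarrow> (\<exists>\<alpha> \<gamma>. \<alpha> \<noteq> 0 \<and> \<gamma> \<noteq> 0 \<and> (d0 = 0 \<and> d1 = \<alpha> + \<gamma> \<or> d0 = \<alpha> \<and> d1 = \<gamma>))"

text \<open>A block triangular map with diagonal blocks 0 and 1, in either order, is idempotent
  whatever its remaining block is. So one idempotent can carry the block \<open>u\<close> from the
  kernel of \<open>p\<close> to its range and the other the block \<open>w\<close> in the opposite
  direction, each divided by its coefficient.\<close>

lemma combination_of_two_idempotents:
  assumes h: "endo h" and p: "endo p" and pp: "\<And>v. p (p v) = p v"
    and d: "shifts d0 d1"
    and h0: "\<And>v. h (v - p v) - p (h (v - p v)) = d0 *s (v - p v)"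
    and h1: "\<And>v. p (h (p v)) = d1 *s p v"
  obtains \<alpha> \<gamma> P E where "idempotent_endo scale P" "idempotent_endo scale E"
    "\<And>v. h v = \<alpha> *s P v + \<gamma> *s E v"
proof -
  note hs = endo_simps[OF h] and ps = endo_simps[OF p]
  obtain \<alpha> \<gamma> where nz: "\<alpha> \<noteq> 0" "\<gamma> \<noteq> 0"
    and cs: "d0 = 0 \<and> d1 = \<alpha> + \<gamma> \<or> d0 = \<alpha> \<and> d1 = \<gamma>"
    using d unfolding shifts_def by blast
  define u where "u v = p (h (v - p v))" for v
  define w where "w v = h (p v) - p (h (p v))" for v
  have u: "endo u" and w: "endo w"
    unfolding u_def w_def endo_iff by (simp_all add: hs ps algebra_simps)
  note us = endo_simps[OF u] and ws = endo_simps[OF w]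
  have pu: "p (u v) = u v" "u (p v) = 0" "u (u v) = 0" "p (w v) = 0" "w (p v) = w v" "w (w v) = 0" for v
    by (simp_all add: u_def w_def pp hs ps)
  have hv: "h v = u v + d0 *s (v - p v) + w v + d1 *s p v" for v
  proof -
    have "h v = h (v - p v) + h (p v)" by (simp add: hs)
    also have "h (v - p v) = d0 *s (v - p v) + u v"
      using h0[of v] by (simp add: u_def algebra_simps)
    also have "h (p v) = w v + d1 *s p v" using h1[of v] by (simp add: w_def)
    finally show ?thesis by (simp add: algebra_simps)
  qed
  define i where "i = inverse \<alpha>"
  define j where "j = inverse \<gamma>"
  have ij: "\<alpha> * i = 1" "\<gamma> * j = 1" using nz by (auto simp: i_def j_def)
  define E where "E v = p v + j *s w v" for v
  have E: "idempotent_endo scale E"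
    unfolding idempotent_endo_def endo_iff fun_eq_iff E_def
    by (simp add: ps ws pu pp algebra_simps)
  have gE: "\<gamma> *s E v = \<gamma> *s p v + w v" for v
    by (simp add: E_def algebra_simps ij)
  show ?thesis
  proof (cases "d0 = 0 \<and> d1 = \<alpha> + \<gamma>")
    case True
    define P where "P v = p v + i *s u v" for v
    have "idempotent_endo scale P"
      unfolding idempotent_endo_def endo_iff fun_eq_iff P_def
      by (simp add: ps us pu pp algebra_simps)
    moreover have "h v = \<alpha> *s P v + \<gamma> *s E v" for v
      using True by (simp add: hv gE P_def algebra_simps ij)
    ultimately show ?thesis using E that by blast
  next
    case False
    define P where "P v = v - p v + i *s u v" for v
    have "idempotent_endo scale P"
      unfolding idempotent_endo_def endo_iff fun_eq_iff P_def
      by (simp add: ps us pu pp algebra_simps)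
    moreover have "h v = \<alpha> *s P v + \<gamma> *s E v" for v
    proof -
      have "d0 = \<alpha>" "d1 = \<gamma>" using False cs by auto
      then show ?thesis by (simp add: hv gE P_def algebra_simps ij)
    qed
    ultimately show ?thesis using E that by blast
  qed
qed


section \<open>Endomorphisms as commutators with a cycle or a shift\<close>

text \<open>
  Here \<open>s\<close> permutes a basis cyclically, \<open>W\<close> is found by recursion along the cycle, and \<open>\<rho> v *s c\<close> repairs
  the one basis vector where the cycle closes; \<open>\<rho> c\<close> plays the role of the trace of \<open>T\<close>.
\<close>

lemma cyclic_commutator:
  assumes B: "finite B" "independent B" and r: "functional r" and ne: "\<exists>x\<in>span B. r x \<noteq> 0"
  obtains s \<rho> where "endo s" "functional \<rho>" "s ` span B = span B"
    "\<And>v. v \<in> span B \<Longrightarrow> \<rho> (s v) = r v"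
    "\<forall>T. endo T \<longrightarrow> T ` span B \<subseteq> span B \<longrightarrow>
      (\<exists>W c. endo W \<and> range W \<subseteq> span B \<and> c \<in> span B \<and>
        (\<forall>v\<in>span B. T v = s (W v) - W (s v) + \<rho> v *s c))"
proof -
  note rs = functional_simps[OF r]
  obtain u where u: "u \<in> span B" "r u = 1"
  proof -
    obtain x where x: "x \<in> span B" "r x \<noteq> 0" using ne by blast
    show ?thesis
      by (rule that[of "inverse (r x) *s x"]) (use x in \<open>auto simp: span_scale rs\<close>)
  qed
  define H where "H = {x \<in> span B. r x = 0}"
  obtain H0 where H0: "H0 \<subseteq> H" "independent H0" "H \<subseteq> span H0"
    using maximal_independent_subset[of H] by blast
  define E where "E = insert u H0"
  have "subspace H" unfolding H_def subspace_def
    by (auto simp: span_zero span_add span_scale rs)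
  then have "span H0 \<subseteq> H" using H0(1) by (rule span_minimal[rotated])
  then have "u \<notin> span H0" using u(2) by (auto simp: H_def)
  then have E: "independent E" "u \<notin> H0"
    using H0(2) by (auto simp: E_def independent_insert span_base)
  have ES: "span E = span B"
  proof
    show "span E \<subseteq> span B"
      using H0(1) u(1) by (intro span_minimal) (auto simp: E_def H_def)
    show "span B \<subseteq> span E"
    proof
      fix v assume v: "v \<in> span B"
      have "v - r v *s u \<in> H"
        unfolding H_def using v u by (auto simp: span_diff span_scale rs)
      then have "v - r v *s u \<in> span E"
        using H0(3) span_mono[of H0 E] by (auto simp: E_def)
      then have "(v - r v *s u) + r v *s u \<in> span E"
        by (intro span_add span_scale) (auto simp: E_def span_base)
      then show "v \<in> span E" by simp
    qed
  qed
  have fin: "finite H0"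
    using independent_span_bound[OF B(1) H0(2)] H0(1) by (auto simp: H_def)
  define n where "n = card H0"
  obtain g0 where g0: "bij_betw g0 {0..<n} H0"
    using ex_bij_betw_nat_finite[OF fin] n_def by blast
  \<comment> \<open>Putting \<open>u\<close> last makes \<open>s\<close> carry
    \<open>g n = u\<close> to \<open>g 0\<close>. On the span, \<open>r\<close> is the coordinate at
    \<open>u\<close> and \<open>\<rho>\<close> the one at \<open>g 0\<close>, hence
    \<open>\<rho> (s v) = r v\<close>.\<close>
  define g where "g i = (if i < n then g0 i else u)" for i
  have gE: "E = g ` {..n}"
    using g0 by (force simp: E_def g_def bij_betw_def image_iff)
  have inj: "inj_on g {..n}"
    using g0 E(2) by (auto simp: inj_on_def g_def bij_betw_def)
  have rg: "r (g i) = (if i = n then 1 else 0)" if "i \<le> n" for i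
  proof (cases "i < n")
    case True
    then have "g i \<in> H" using g0 H0(1) by (auto simp: g_def bij_betw_def)
    then show ?thesis using True by (simp add: H_def)
  qed (use that u in \<open>simp add: g_def\<close>)
  have ext: "\<exists>h. endo h \<and> range h = span (t ` {..n}) \<and> (\<forall>i\<le>n. h (g i) = t i)" for t
  proof -
    obtain h where h: "endo h" "\<And>x. x \<in> E \<Longrightarrow> h x = t (inv_into {..n} g x)"
      "range h = span ((\<lambda>x. t (inv_into {..n} g x)) ` E)"
      by (rule endo_extend[OF E(1)]) (rule that)
    have "(\<lambda>x. t (inv_into {..n} g x)) ` E = t ` {..n}"
      unfolding gE image_image using inj by (intro image_cong) auto
    with h inj show ?thesis by (intro exI[of _ h]) (auto simp: gE)
  qed
  obtain s where s: "endo s" "range s = span ((\<lambda>i. if i < n then g (Suc i) else g 0) ` {..n})"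
    "\<And>i. i \<le> n \<Longrightarrow> s (g i) = (if i < n then g (Suc i) else g 0)"
    using ext[of "\<lambda>i. if i < n then g (Suc i) else g 0"] by blast
  obtain \<rho> where \<rho>: "functional \<rho>" "\<And>x. x \<in> E \<Longrightarrow> \<rho> x = (if x = g 0 then 1 else 0)"
    by (rule functional_extend[OF E(1)]) (rule that)
  note ss = endo_simps[OF s(1)] and \<rho>s = functional_simps[OF \<rho>(1)]
  have sE: "s ` E = E"
  proof -
    have "(\<lambda>i. if i < n then g (Suc i) else g 0) ` {..n} = g ` {..n}"
    proof (intro equalityI subsetI)
      fix x assume "x \<in> g ` {..n}"
      then obtain i where i: "x = g i" "i \<le> n" by auto
      show "x \<in> (\<lambda>i. if i < n then g (Suc i) else g 0) ` {..n}"
        by (cases i) (use i in \<open>auto intro: rev_image_eqI[of n] rev_image_eqI[of "i - 1"]\<close>)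
    qed auto
    moreover have "s ` E = (\<lambda>i. if i < n then g (Suc i) else g 0) ` {..n}"
      unfolding gE image_image by (rule image_cong) (use s(3) in auto)
    ultimately show ?thesis by (simp only: gE)
  qed
  have s_onto: "s ` span E = span E"
  proof -
    interpret s: Vector_Spaces.linear scale scale s by (rule s(1))
    show ?thesis using s.span_image[of E] sE by simp
  qed
  have rho_s: "\<rho> (s v) = r v" if "v \<in> span E" for v
  proof -
    have "subspace {v. \<rho> (s v) = r v}"
      unfolding subspace_def by (auto simp: rs \<rho>s ss)
    moreover have "E \<subseteq> {v. \<rho> (s v) = r v}"
    proof
      fix x assume "x \<in> E"
      then obtain i where i: "x = g i" "i \<le> n" unfolding gE by auto
      have "g (Suc i) \<noteq> g 0" "g (Suc i) \<in> E" if "i < n"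
        using inj_onD[OF inj, of "Suc i" 0] that by (auto simp: gE)
      moreover have "g 0 \<in> E" by (auto simp: gE)
      ultimately show "x \<in> {v. \<rho> (s v) = r v}"
        using i by (auto simp: s(3) rg \<rho>(2))
    qed
    ultimately show ?thesis using that span_minimal by blast
  qed
  have comm: "\<exists>W c. endo W \<and> range W \<subseteq> span E \<and> c \<in> span E \<and>
      (\<forall>v\<in>span E. T v = s (W v) - W (s v) + \<rho> v *s c)"
    if T: "endo T" "\<And>v. v \<in> span E \<Longrightarrow> T v \<in> span E" for T
  proof -
    \<comment> \<open>\<open>F i\<close> is the value of \<open>W\<close> at \<open>s (g i)\<close>.
      It starts with the free choice 0 and is then forced by the commutator equation at
      \<open>g i\<close>, ending at \<open>s (g n) = g 0\<close>. Only the equation at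
      \<open>g 0\<close> is left over, and \<open>c\<close> is its error.\<close>
    define F where "F = rec_nat 0 (\<lambda>i x. s x - T (g (Suc i)))"
    have F: "F 0 = 0" "F (Suc i) = s (F i) - T (g (Suc i))" for i
      by (simp_all add: F_def)
    have sspan: "s x \<in> span E" if "x \<in> span E" for x
      using s_onto that by blast
    have gspan: "g i \<in> span E" if "i \<le> n" for i
      using that by (intro span_base) (auto simp: gE)
    have Fspan: "i \<le> n \<Longrightarrow> F i \<in> span E" for i
      by (induction i) (auto simp: F span_zero intro!: span_diff sspan T gspan)
    obtain W where W: "endo W"
      "range W = span ((\<lambda>i. if i = 0 then F n else F (i - 1)) ` {..n})"
      "\<And>i. i \<le> n \<Longrightarrow> W (g i) = (if i = 0 then F n else F (i - 1))"
      using ext[of "\<lambda>i. if i = 0 then F n else F (i - 1)"] by blast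
    have Wr: "range W \<subseteq> span E"
      unfolding W(2) by (intro span_minimal) (auto intro!: Fspan)
    note Ts = endo_simps[OF T(1)] and Ws = endo_simps[OF W(1)]
    define c where "c = T (g 0) - (s (W (g 0)) - W (s (g 0)))"
    have c: "c \<in> span E"
      unfolding c_def using Wr T gspan[of 0] by (auto intro!: span_diff sspan)
    have "T v = s (W v) - W (s v) + \<rho> v *s c" if "v \<in> span E" for v
    proof (rule endo_eq_on_span[OF T(1) _ _ that])
      show "endo (\<lambda>v. s (W v) - W (s v) + \<rho> v *s c)"
        unfolding endo_iff by (simp add: ss Ws \<rho>s algebra_simps)
      fix x assume "x \<in> E"
      then obtain i where i: "x = g i" "i \<le> n" unfolding gE by auto
      show "T x = s (W x) - W (s x) + \<rho> x *s c"
      proof (cases i)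
        case 0
        then have "\<rho> x = 1" using i \<open>x \<in> E\<close> by (simp add: \<rho>(2))
        then show ?thesis using 0 i by (simp add: c_def)
      next
        case (Suc k)
        then have "x \<noteq> g 0" using inj_onD[OF inj, of i 0] i by auto
        then have "\<rho> x = 0" using \<open>x \<in> E\<close> by (simp add: \<rho>(2))
        moreover have "s (W x) = s (F k)" using Suc i by (simp add: W(3))
        moreover have "W (s x) = F (Suc k)"
        proof (cases "i < n")
          case True
          then show ?thesis using Suc i by (simp add: s(3) W(3))
        next
          case False
          then have "i = n" using i by simp
          then show ?thesis using i Suc by (simp add: s(3) W(3))
        qed
        ultimately show ?thesis using i Suc by (simp add: F)
      qed
    qed
    then show ?thesis using W(1) Wr c by blast
  qed
  show ?thesis
  proof (rule that[OF s(1) \<rho>(1) s_onto[unfolded ES]])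
    show "\<rho> (s v) = r v" if "v \<in> span B" for v
      using rho_s that unfolding ES by blast
    show "\<forall>T. endo T \<longrightarrow> T ` span B \<subseteq> span B \<longrightarrow>
      (\<exists>W c. endo W \<and> range W \<subseteq> span B \<and> c \<in> span B \<and>
        (\<forall>v\<in>span B. T v = s (W v) - W (s v) + \<rho> v *s c))"
      using comm unfolding ES image_subset_iff by blast
  qed
qed

text \<open>As \<open>B\<close> is in bijection with the product of the natural numbers and
  \<open>B\<close>, it admits a shift \<open>s\<close> of the first coordinate. Its orbits never
  close, so \<open>W (s v) = s (W v) - T v\<close> is solved along each of them without a correction
  term. Moreover a map can be prescribed on the image of \<open>s\<close> and independently at the
  starting points of the orbits, one of which is \<open>e\<close>.\<close>

lemma shift_commutator:
  includes cardinal_syntax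
  assumes B: "infinite B" "independent B"
  obtains s e where "endo s" "range s \<subseteq> span B" "e \<in> span B"
    "\<forall>T. endo T \<longrightarrow> T ` span B \<subseteq> span B \<longrightarrow>
      (\<exists>W. endo W \<and> range W \<subseteq> span B \<and> (\<forall>v\<in>span B. T v = s (W v) - W (s v)))"
    "\<forall>g y. endo g \<longrightarrow> (\<exists>\<rho>. endo \<rho> \<and> (\<forall>v\<in>span B. \<rho> (s v) = g v) \<and> \<rho> e = y \<and>
        range \<rho> \<subseteq> span (insert y (range g)))"
proof -
  have "|UNIV :: nat set| \<le>o |B|"
    using B(1) infinite_iff_card_of_nat by blast
  then have "|(UNIV :: nat set) \<times> B| =o |B|"
    using card_of_Times_infinite[OF B(1), of "UNIV :: nat set"] by auto
  then obtain h where h: "bij_betw h ((UNIV :: nat set) \<times> B) B"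
    using card_of_ordIso by blast
  then have hB: "h (n, i) \<in> B" if "i \<in> B" for n i
    using that by (auto simp: bij_betw_def)
  define k where "k = inv_into ((UNIV :: nat set) \<times> B) h"
  have k: "k (h (n, i)) = (n, i)" if "i \<in> B" for n i
    unfolding k_def using h that by (auto simp: bij_betw_def)
  have cases: "\<exists>n i. i \<in> B \<and> x = h (n, i)" if "x \<in> B" for x
  proof -
    have "x \<in> h ` (UNIV \<times> B)" using h that by (simp add: bij_betw_def)
    then show ?thesis by auto
  qed
  have ext: "\<exists>g. endo g \<and> range g = span {t n i | n i. i \<in> B} \<and> (\<forall>n. \<forall>i\<in>B. g (h (n, i)) = t n i)" for t
  proof -
    obtain g where g: "endo g" "\<And>x. x \<in> B \<Longrightarrow> g x = t (fst (k x)) (snd (k x))"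
      "range g = span ((\<lambda>x. t (fst (k x)) (snd (k x))) ` B)"
      by (rule endo_extend[OF B(2)]) (rule that)
    have "(\<lambda>x. t (fst (k x)) (snd (k x))) ` B = {t n i | n i. i \<in> B}"
    proof (intro equalityI subsetI)
      fix y assume "y \<in> (\<lambda>x. t (fst (k x)) (snd (k x))) ` B"
      then obtain x where x: "x \<in> B" "y = t (fst (k x)) (snd (k x))" by blast
      obtain n i where "i \<in> B" "x = h (n, i)" using cases[OF x(1)] by blast
      then have "i \<in> B" "y = t n i" using x(2) k by simp_all
      then show "y \<in> {t n i | n i. i \<in> B}" by blast
    next
      fix y assume "y \<in> {t n i | n i. i \<in> B}"
      then obtain n i where "i \<in> B" "y = t n i" by blast
      then show "y \<in> (\<lambda>x. t (fst (k x)) (snd (k x))) ` B"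
        using k hB by (intro image_eqI[of _ _ "h (n, i)"]) auto
    qed
    moreover have "g (h (n, i)) = t n i" if "i \<in> B" for n i
      using g(2)[OF hB[OF that, of n]] k[OF that, of n] by simp
    ultimately show ?thesis using g(1,3) by metis
  qed
  obtain i0 where i0: "i0 \<in> B" using B(1) by (metis finite.emptyI all_not_in_conv)
  obtain s where s: "endo s" "range s = span {h (Suc n, i) | n i. i \<in> B}"
    "\<And>n i. i \<in> B \<Longrightarrow> s (h (n, i)) = h (Suc n, i)"
    using ext[of "\<lambda>n i. h (Suc n, i)"] by blast
  note ss = endo_simps[OF s(1)]
  have sr: "range s \<subseteq> span B"
    unfolding s(2) using hB by (intro span_mono) auto
  show ?thesis
  proof (rule that[OF s(1) sr span_base[OF hB[OF i0, of 0]]]; intro allI impI)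
    fix T assume T: "endo T" and "T ` span B \<subseteq> span B"
    then have T2: "T v \<in> span B" if "v \<in> span B" for v using that by blast
    define F where "F n i = rec_nat 0 (\<lambda>n x. s x - T (h (n, i))) n" for n i
    have F: "F 0 i = 0" "F (Suc n) i = s (F n i) - T (h (n, i))" for n i
      by (simp_all add: F_def)
    have Fspan: "F n i \<in> span B" if "i \<in> B" for n i
    proof (induction n)
      case (Suc n)
      then show ?case unfolding F by (intro span_diff T2 span_base[OF hB[OF that]]) (use sr in blast)
    qed (simp add: F span_zero)
    obtain W where W: "endo W" "range W = span {F n i | n i. i \<in> B}"
      "\<And>n i. i \<in> B \<Longrightarrow> W (h (n, i)) = F n i"
      using ext[of F] by blast
    have "range W \<subseteq> span B"
      unfolding W(2) by (intro span_minimal) (auto intro: Fspan)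
    moreover have "T v = s (W v) - W (s v)" if "v \<in> span B" for v
    proof (rule endo_eq_on_span[OF T _ _ that])
      show "endo (\<lambda>v. s (W v) - W (s v))"
        unfolding endo_iff by (simp add: ss endo_simps[OF W(1)] algebra_simps)
      fix x assume "x \<in> B"
      then obtain n i where "i \<in> B" "x = h (n, i)" using cases by blast
      then show "T x = s (W x) - W (s x)" by (simp add: s(3) W(3) F)
    qed
    ultimately show "\<exists>W. endo W \<and> range W \<subseteq> span B \<and> (\<forall>v\<in>span B. T v = s (W v) - W (s v))"
      using W(1) by blast
  next
    fix g y assume g: "endo g"
    obtain \<rho> where \<rho>: "endo \<rho>" "range \<rho> = span {case n of 0 \<Rightarrow> y | Suc n \<Rightarrow> g (h (n, i)) | n i. i \<in> B}"
      "\<And>n i. i \<in> B \<Longrightarrow> \<rho> (h (n, i)) = (case n of 0 \<Rightarrow> y | Suc n \<Rightarrow> g (h (n, i)))"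
      using ext[of "\<lambda>n i. case n of 0 \<Rightarrow> y | Suc n \<Rightarrow> g (h (n, i))"] by blast
    have "range \<rho> \<subseteq> span (insert y (range g))"
      unfolding \<rho>(2) by (intro span_mono) (auto split: nat.splits dest!: gr0_implies_Suc)
    moreover have "\<rho> (s v) = g v" if "v \<in> span B" for v
    proof (rule endo_eq_on_span[OF _ g _ that])
      show "endo (\<lambda>v. \<rho> (s v))"
        unfolding endo_iff by (simp add: ss endo_simps[OF \<rho>(1)])
      fix x assume "x \<in> B"
      then obtain n i where "i \<in> B" "x = h (n, i)" using cases by blast
      then show "\<rho> (s x) = g x" by (simp add: s(3) \<rho>(3))
    qed
    ultimately show "\<exists>\<rho>. endo \<rho> \<and> (\<forall>v\<in>span B. \<rho> (s v) = g v) \<and> \<rho> (h (0, i0)) = y \<and>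
        range \<rho> \<subseteq> span (insert y (range g))"
      using \<rho>(1) \<rho>(3)[OF i0, of 0] by auto
  qed
qed

section \<open>Common eigenvectors and a maximal displaced set\<close>

lemma scalar_if_all_eigenvectors:
  assumes T: "endo T" and M: "subspace M" and ev: "\<And>v. v \<in> M \<Longrightarrow> \<exists>l. T v = l *s v"
  shows "\<exists>l. \<forall>v\<in>M. T v = l *s v"
proof (cases "M \<subseteq> {0}")
  case True
  have "T v = 0 *s v" if "v \<in> M" for v
  proof -
    have "v = 0" using True that by auto
    then show ?thesis by (simp add: endo_simps[OF T])
  qed
  then show ?thesis by blast
next
  case False
  then obtain u where u: "u \<in> M" "u \<noteq> 0" by auto
  obtain l where l: "T u = l *s u" using ev[OF u(1)] by blast
  have "T v = l *s v" if v: "v \<in> M" for v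
  proof (cases "\<exists>k. v = k *s u")
    case True
    then show ?thesis using l by (auto simp: endo_simps[OF T] mult.commute)
  next
    case ind: False
    obtain l1 where l1: "T v = l1 *s v" using ev[OF v] by blast
    obtain l2 where l2: "T (u + v) = l2 *s (u + v)"
      using ev M u(1) v subspace_add by blast
    have eq: "(l1 - l2) *s v = (l2 - l) *s u"
      using l2 by (simp add: endo_simps[OF T] l l1 algebra_simps)
    have "l1 = l2"
    proof (rule ccontr)
      assume "l1 \<noteq> l2"
      then have "v = inverse (l1 - l2) *s (l1 - l2) *s v" by simp
      also have "\<dots> = (inverse (l1 - l2) * (l2 - l)) *s u" unfolding eq by simp
      finally show False using ind by blast
    qed
    then have "l2 = l" using eq u(2) by simp
    then show ?thesis using l1 \<open>l1 = l2\<close> by simp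
  qed
  then show ?thesis by blast
qed

text \<open>The conditions in \<open>good\<close> say that \<open>f\<close> maps the basis
  \<open>B\<close> of K bijectively onto a basis of f K, and that K and f K are independent. They
  pass to unions of chains, and adjoining \<open>v\<close> preserves them as soon as
  \<open>v\<close> and then \<open>f v\<close> are new, which maximality forbids.\<close>

lemma maximal_displaced_set:
  assumes f: "endo f"
  obtains B where "inj_on f B" "B \<inter> f ` B = {}" "independent (B \<union> f ` B)"
    "\<And>v. v \<notin> span (B \<union> f ` B) \<Longrightarrow> f v \<in> span (insert v (B \<union> f ` B))"
proof -
  define good where "good B \<longleftrightarrow> inj_on f B \<and> B \<inter> f ` B = {} \<and> independent (B \<union> f ` B)" for B
  have "\<exists>B\<in>Collect good. \<forall>X\<in>Collect good. B \<subseteq> X \<longrightarrow> X = B"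
  proof (rule subset_Zorn_nonempty)
    have "good {}" by (simp add: good_def independent_empty)
    then show "Collect good \<noteq> {}" by blast
    fix C assume "C \<noteq> {}" and C: "subset.chain (Collect good) C"
    have dir: "X \<subseteq> Y \<or> Y \<subseteq> X" if "X \<in> C" "Y \<in> C" for X Y
      using C that by (auto simp: subset_chain_def)
    have g: "good X" if "X \<in> C" for X
      using C that by (auto simp: subset_chain_def)
    have "inj_on f (\<Union>C)"
    proof (rule inj_onI)
      fix x y assume xy: "x \<in> \<Union>C" "y \<in> \<Union>C" "f x = f y"
      then obtain X where "X \<in> C" "x \<in> X" "y \<in> X" using dir by (meson UnionE subsetD)
      then show "x = y" using g xy(3) by (auto simp: good_def inj_on_def)
    qed
    moreover have "\<Union>C \<inter> f ` \<Union>C = {}"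
    proof (rule ccontr)
      assume "\<Union>C \<inter> f ` \<Union>C \<noteq> {}"
      then obtain x where x: "f x \<in> \<Union>C" "x \<in> \<Union>C" by auto
      then obtain X where "X \<in> C" "f x \<in> X" "x \<in> X" using dir by (meson UnionE subsetD)
      then show False using g by (auto simp: good_def)
    qed
    moreover have "independent (\<Union>C \<union> f ` \<Union>C)"
    proof -
      have "\<Union>C \<union> f ` \<Union>C = \<Union> ((\<lambda>X. X \<union> f ` X) ` C)" by auto
      moreover have "independent (\<Union> ((\<lambda>X. X \<union> f ` X) ` C))"
      proof (rule independent_Union_directed)
        fix c d assume "c \<in> (\<lambda>X. X \<union> f ` X) ` C" "d \<in> (\<lambda>X. X \<union> f ` X) ` C"
        then obtain X Y where XY: "X \<in> C" "Y \<in> C" "c = X \<union> f ` X" "d = Y \<union> f ` Y" by blast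
        from dir[OF XY(1,2)] show "c \<subseteq> d \<or> d \<subseteq> c" unfolding XY(3,4) by blast
      qed (use g in \<open>auto simp: good_def\<close>)
      ultimately show ?thesis by simp
    qed
    ultimately show "\<Union>C \<in> Collect good" by (simp add: good_def)
  qed
  then obtain B where B: "good B" and max: "\<And>X. good X \<Longrightarrow> B \<subseteq> X \<Longrightarrow> X = B" by auto
  show ?thesis
  proof (rule that[of B])
    fix v assume v: "v \<notin> span (B \<union> f ` B)"
    show "f v \<in> span (insert v (B \<union> f ` B))"
    proof (rule ccontr)
      assume fv: "f v \<notin> span (insert v (B \<union> f ` B))"
      have ind: "independent (insert (f v) (insert v (B \<union> f ` B)))"
        using B v fv by (auto simp: good_def independent_insert)
      have new: "v \<notin> B" "v \<notin> f ` B" "f v \<noteq> v" "f v \<notin> B" "f v \<notin> f ` B"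
      proof -
        have 1: "x \<noteq> v" if "x \<in> B \<union> f ` B" for x
          using v span_base[OF that] by blast
        have 2: "x \<noteq> f v" if "x \<in> insert v (B \<union> f ` B)" for x
          using fv span_base[OF that] by blast
        show "v \<notin> B" "v \<notin> f ` B" "f v \<noteq> v" "f v \<notin> B" "f v \<notin> f ` B"
          using 1[of v] 2[of v] 2[of "f v"] by auto
      qed
      have "good (insert v B)"
      proof -
        have "inj_on f (insert v B)" using B new by (auto simp: good_def)
        moreover have "insert v B \<inter> f ` insert v B = {}"
          using B new by (auto simp: good_def)
        moreover have "insert v B \<union> f ` insert v B = insert (f v) (insert v (B \<union> f ` B))" by auto
        ultimately show ?thesis using ind by (simp add: good_def)
      qed
      then have "insert v B = B" by (rule max) auto
      then show False using new by blast
    qed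
  qed (use B in \<open>auto simp: good_def\<close>)
qed

end

section \<open>The criterion for three idempotents in terms of a splitting\<close>

text \<open>
  \<open>a\<close>, \<open>f \<circ> b\<close> and \<open>m\<close> are the projections belonging to \<open>V = K + f K + M\<close>; membership in \<open>K\<close> and \<open>M\<close>
  is expressed by \<open>a v = v\<close> and \<open>m v = v\<close>, and \<open>S\<close> from the introduction is \<open>b \<circ> f \<circ> f\<close>.
\<close>

locale splitting = endomorphisms scale
  for scale :: "'a::field \<Rightarrow> 'b::ab_group_add \<Rightarrow> 'b" (infixr "*s" 75) +
  fixes f a b m :: "'b \<Rightarrow> 'b"
  assumes f: "endo f" and a: "endo a" and b: "endo b" and m: "endo m"
    and split: "a v + f (b v) + m v = v"
    and aa: "a (a v) = a v" and ba: "b (a v) = 0" and ma: "m (a v) = 0"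
    and ab: "a (b v) = b v"
    and af: "a (f (a v)) = 0" and bf: "b (f (a v)) = a v" and mf: "m (f (a v)) = 0"
    and am: "a (m v) = 0" and bm: "b (m v) = 0" and mm: "m (m v) = m v"
begin

lemmas f_simps = endo_simps[OF f]
lemmas a_simps = endo_simps[OF a]
lemmas b_simps = endo_simps[OF b]
lemmas m_simps = endo_simps[OF m]

lemma a_fixed:
  assumes "a x = x"
  shows "b x = 0" "m x = 0" "a (f x) = 0" "b (f x) = x" "m (f x) = 0"
  using ba[of x] ma[of x] af[of x] bf[of x] mf[of x] assms by simp_all

lemma m_fixed:
  assumes "m x = x"
  shows "a x = 0" "b x = 0"
  using am[of x] bm[of x] assms by simp_all

text \<open>
  The idempotent is \<open>Q = (C, c; 1) (R; 1 - R C)\<close>, modified by \<open>\<sigma>\<close> and \<open>q\<close> to lower its rank. The complement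
  of \<open>K\<close> is sheared by \<open>X\<close> and \<open>U\<close> so that the block of \<open>f\<close> on \<open>K\<close> becomes that of \<open>\<beta> Q\<close> and the entry
  from \<open>M\<close> to \<open>f K\<close> is matched as well.
\<close>

lemma three_idempotentsI:
  assumes maps: "endo C" "endo R" "endo \<sigma>" "endo c" "endo \<rho>" "endo q"
    and K: "\<And>v. a (C v) = C v" "\<And>v. a (R v) = R v" "\<And>v. a (\<sigma> v) = \<sigma> v" "\<And>v. a (c v) = c v"
    and M: "\<And>v. m (\<rho> v) = \<rho> v" "\<And>v. m (q v) = q v"
    and \<sigma>: "\<And>v. \<sigma> (\<sigma> v) = \<sigma> v" "\<And>v. \<sigma> (R v) = R v"
    and q: "\<And>v. q (q v) = q v" "\<And>v. q (\<rho> v) = \<rho> v"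
    and d: "shifts d0 d1" and \<beta>: "\<beta> \<noteq> 0"
    and S: "\<And>v. a v = v \<Longrightarrow>
      b (f (f v)) = (d0 + d1) *s v + \<beta> *s (\<sigma> v + C (R v) - R (C v) + c (\<rho> v))"
    and W: "\<And>v. a v = v \<Longrightarrow> m (f (f v)) = - (\<beta> *s \<rho> (C v))"
    and L: "\<And>v. m v = v \<Longrightarrow> m (f v) = d1 *s v + \<beta> *s (q v - \<rho> (c v))"
  shows "three_idempotents f"
proof -
  note ls = f_simps a_simps b_simps m_simps endo_simps[OF maps(1)] endo_simps[OF maps(2)]
    endo_simps[OF maps(3)] endo_simps[OF maps(4)] endo_simps[OF maps(5)] endo_simps[OF maps(6)]
  note Kf = a_fixed[OF K(1)] a_fixed[OF K(2)] a_fixed[OF K(3)] a_fixed[OF K(4)] a_fixed[OF ab]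
  note Mf = m_fixed[OF M(1)] m_fixed[OF M(2)]
  \<comment> \<open>After the shear the component of \<open>f k\<close> in K is \<open>X k\<close>,
    so this value leaves the block \<open>d0\<close> for \<open>h\<close> on K. \<open>U\<close>
    solves \<open>b (f x) - U x = - (\<beta> *s R (c x))\<close>, which cancels the entry of
    \<open>h\<close> from M to f K.\<close>
  define X where "X k = d0 *s k + \<beta> *s (C (R k) + c (\<rho> k))" for k
  define U where "U x = b (f x) + \<beta> *s R (c x)" for x
  \<comment> \<open>\<open>a'\<close> is the projection onto K along the vectors
    \<open>f k - X k\<close> and \<open>x - U x\<close> with k in K and x in M; \<open>b\<close> and
    \<open>m\<close> still give the other two coordinates.\<close>
  define a' where "a' v = a v + X (b v) + U (m v)" for v
  \<comment> \<open>\<open>y\<close> and \<open>z\<close> are the values of the two rows of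
    \<open>Q\<close> in these coordinates; the column factor is then applied to them. Rows times
    column is diagonal with entries \<open>\<sigma>\<close> and \<open>q\<close>, and this diagonal
    map fixes the rows, so \<open>Q\<close> is idempotent.\<close>
  define y where "y v = R (a' v) + \<sigma> (b v) - R (C (b v) + c (m v))" for v
  define z where "z v = \<rho> (a' v) + q (m v) - \<rho> (C (b v) + c (m v))" for v
  define Q where "Q v = C (y v) + c (z v) + (f (y v) - X (y v)) + (z v - U (z v))" for v
  define p where "p v = v - a' v" for v
  define h where "h v = f v - \<beta> *s Q v" for v
  have X: "endo X" and U: "endo U"
    unfolding X_def U_def endo_iff by (simp_all add: ls algebra_simps)
  have a': "endo a'"
    unfolding a'_def endo_iff by (simp add: ls endo_simps[OF X] endo_simps[OF U] algebra_simps)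
  have yz: "endo y" "endo z"
    unfolding y_def z_def endo_iff by (simp_all add: ls endo_simps[OF a'] algebra_simps)
  note ls' = ls endo_simps[OF X] endo_simps[OF U] endo_simps[OF a'] endo_simps[OF yz(1)] endo_simps[OF yz(2)]
  have Q: "endo Q"
    unfolding Q_def endo_iff by (simp add: ls' algebra_simps)
  have h: "endo h" and p: "endo p"
    unfolding h_def p_def endo_iff by (simp_all add: ls' endo_simps[OF Q] algebra_simps)
  have aX: "a (X k) = X k" if "a k = k" for k
    by (simp add: X_def ls that K)
  have aU: "a (U x) = U x" for x
    by (simp add: U_def ls K ab)
  have aa': "a (a' v) = a' v" for v
    by (simp add: a'_def ls aa aX ab aU)
  have a'_fixed: "a' k = k" if "a k = k" for k
    using a_fixed(1,2)[OF that] by (simp add: a'_def that ls')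
  have ay: "a (y v) = y v" and mz: "m (z v) = z v" for v
    by (simp_all add: y_def z_def ls K M)
  note yf = a_fixed[OF ay] a_fixed[OF aX[OF ay]] a_fixed[OF aU] m_fixed[OF mz]
  have bQ: "b (Q v) = y v" and mQ: "m (Q v) = z v" for v
    by (simp_all add: Q_def ls Kf Mf yf mz)
  have a'Q: "a' (Q v) = C (y v) + c (z v)" for v
  proof -
    have "a (Q v) = C (y v) + c (z v) - X (y v) - U (z v)"
      by (simp add: Q_def ls K yf aX ay aU)
    then show ?thesis by (simp add: a'_def bQ mQ)
  qed
  have "y (Q v) = y v" for v
  proof -
    have "y (Q v) = \<sigma> (y v)" by (simp add: y_def[of "Q v"] a'Q bQ mQ)
    then show ?thesis by (simp add: y_def ls \<sigma>)
  qed
  moreover have "z (Q v) = z v" for v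
  proof -
    have "z (Q v) = q (z v)" by (simp add: z_def[of "Q v"] a'Q bQ mQ)
    then show ?thesis by (simp add: z_def ls q)
  qed
  ultimately have "Q (Q v) = Q v" for v
    by (simp add: Q_def[of "Q v"]) (simp add: Q_def)
  then have Qid: "idempotent_endo scale Q"
    using Q by (simp add: idempotent_endo_def fun_eq_iff)
  have pp: "p (p v) = p v" for v
    by (simp add: p_def ls' a'_fixed aa')
  have h0: "h (v - p v) - p (h (v - p v)) = d0 *s (v - p v)" for v
  proof -
    define k where "k = a' v"
    have k: "a k = k" by (simp add: k_def aa')
    have "a' (f k) = X k" by (simp add: a'_def a_fixed[OF k] ls')
    moreover have "y k = R k" "z k = \<rho> k"
      by (simp_all add: y_def z_def a_fixed[OF k] a'_fixed[OF k] ls')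
    ultimately have "a' (h k) = d0 *s k"
      by (simp add: h_def ls' a'Q X_def)
    then show ?thesis by (simp add: p_def k_def)
  qed
  have h1: "p (h (p v)) = d1 *s p v" for v
  proof -
    have pv: "p v = f (b v) - X (b v) + m v - U (m v)" for v
      using split[of v] by (simp add: p_def a'_def algebra_simps)
    define l where "l = p v"
    have "a' l = 0" by (simp add: l_def p_def ls' a'_fixed aa')
    have lb: "b l = b v" "m l = m v"
      by (simp_all add: l_def pv ls Kf yf a_fixed[OF aX[OF ab]] bm mm)
    have yl: "y l = \<sigma> (b v) - R (C (b v)) - R (c (m v))"
      and zl: "z l = q (m v) - \<rho> (C (b v)) - \<rho> (c (m v))"
      by (simp_all add: y_def z_def \<open>a' l = 0\<close> lb ls')
    have fl: "f l = f (f (b v)) - f (X (b v)) + f (m v) - f (U (m v))"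
      by (simp add: l_def pv ls)
    have "b (f l) = b (f (f (b v))) - X (b v) - \<beta> *s R (c (m v))"
      by (simp add: fl ls a_fixed[OF aX[OF ab]] yf U_def[of "m v"] K) (simp add: U_def a_fixed[OF K(2)] Kf ls)
    \<comment> \<open>The shear subtracts from the block on f K exactly the \<open>X\<close> it put
      on K, so only the sum of the two blocks enters the hypothesis \<open>S\<close>.\<close>
    then have bh: "b (h l) = d1 *s b v"
      using S[OF ab, of v] by (simp add: h_def ls bQ yl X_def algebra_simps)
    have "m (f l) = m (f (f (b v))) + m (f (m v))"
      by (simp add: fl ls a_fixed[OF aX[OF ab]] yf)
    then have mh: "m (h l) = d1 *s m v"
      using W[OF ab, of v] L[OF mm, of v] by (simp add: h_def ls mQ zl algebra_simps)
    have "p (h l) = d1 *s p v"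
      unfolding pv bh mh by (simp add: ls' algebra_simps)
    then show ?thesis by (simp add: l_def)
  qed
  show ?thesis
  proof (rule combination_of_two_idempotents[where h = h and p = p, OF h p pp d h0 h1])
    fix P E \<alpha> \<gamma>
    assume PE: "idempotent_endo scale P" "idempotent_endo scale E"
      and hv: "\<And>v. h v = \<alpha> *s P v + \<gamma> *s E v"
    have "f = (\<lambda>v. \<alpha> *s P v + \<gamma> *s E v + \<beta> *s Q v)"
    proof
      fix v
      show "f v = \<alpha> *s P v + \<gamma> *s E v + \<beta> *s Q v"
        using hv[of v] by (simp add: h_def algebra_simps)
    qed
    then show "three_idempotents f"
      unfolding three_idempotents_def using PE Qid by blast
  qed
qed

end

section \<open>Existence of a splitting with K maximal\<close>

context endomorphisms
begin

lemma splitting_exists: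
  assumes f: "endo f"
  obtains a b m B where "splitting scale f a b m" "independent B" "range a = span B"
    "\<And>v. m v \<noteq> 0 \<Longrightarrow> \<exists>l. m (f v) = l *s m v"
proof -
  note fs = endo_simps[OF f]
  obtain B where inj: "inj_on f B" and dj: "B \<inter> f ` B = {}" and ind: "independent (B \<union> f ` B)"
    and max: "\<And>v. v \<notin> span (B \<union> f ` B) \<Longrightarrow> f v \<in> span (insert v (B \<union> f ` B))"
    by (rule maximal_displaced_set[OF f]) (rule that)
  define E where "E = extend_basis (B \<union> f ` B)"
  have E: "independent E" "span E = UNIV" "B \<union> f ` B \<subseteq> E"
    unfolding E_def using ind independent_extend_basis extend_basis_superset by auto
  obtain a where a: "endo a" "\<And>x. x \<in> E \<Longrightarrow> a x = (if x \<in> B then x else 0)"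
    "range a = span ((\<lambda>x. if x \<in> B then x else 0) ` E)"
    by (rule endo_extend[OF E(1)]) (rule that)
  obtain b where b: "endo b" "\<And>x. x \<in> E \<Longrightarrow> b x = (if x \<in> f ` B then inv_into B f x else 0)"
    by (rule endo_extend[OF E(1)]) (rule that)
  obtain m where m: "endo m" "\<And>x. x \<in> E \<Longrightarrow> m x = (if x \<in> B \<union> f ` B then 0 else x)"
    by (rule endo_extend[OF E(1)]) (rule that)
  note ls = fs endo_simps[OF a(1)] endo_simps[OF b(1)] endo_simps[OF m(1)]
  have eq: "g v = h v" if "endo g" "endo h" "\<And>x. x \<in> E \<Longrightarrow> g x = h x" for g h v
    using endo_eq_on_span[OF that, where x = v] E(2) by simp
  have l: "endo (\<lambda>v. v)" "endo (\<lambda>v. 0)" by (auto simp: endo_iff)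
  have BE: "a x = x" "b x = 0" "m x = 0" "a (f x) = 0" "b (f x) = x" "m (f x) = 0" if "x \<in> B" for x
  proof -
    have "x \<notin> f ` B" "f x \<notin> B" "x \<in> E" "f x \<in> E" using that dj E(3) by blast+
    then show "a x = x" "b x = 0" "m x = 0" "a (f x) = 0" "b (f x) = x" "m (f x) = 0"
      using that inj by (simp_all add: a b m)
  qed
  \<comment> \<open>A basis vector lies in \<open>B\<close>, in its image under \<open>f\<close>, or
    in neither, where \<open>m\<close> is the identity. The projection identities are linear, so
    these three cases suffice.\<close>
  have onE: "P x" if "x \<in> E" "\<And>x. x \<in> B \<Longrightarrow> P x" "\<And>x. x \<in> B \<Longrightarrow> P (f x)"
    "\<And>x. \<lbrakk>a x = 0; b x = 0; m x = x\<rbrakk> \<Longrightarrow> P x" for P x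
    using that a(2)[OF that(1)] b(2)[OF that(1)] m(2)[OF that(1)] by (cases "x \<in> B \<union> f ` B") auto
  have "splitting scale f a b m"
  proof (intro splitting.intro splitting_axioms.intro)
    fix v
    show "endomorphisms scale" by (fact endomorphisms_axioms)
    show "endo f" "endo a" "endo b" "endo m" by (fact f a b m)+
    have "endo (\<lambda>v. a v + f (b v) + m v)" by (simp add: endo_iff ls algebra_simps)
    then show "a v + f (b v) + m v = v"
      by (rule eq[OF _ l(1)]) (erule onE; simp add: BE ls)
    have c: "endo (\<lambda>v. a (a v))" "endo (\<lambda>v. b (a v))" "endo (\<lambda>v. m (a v))" "endo (\<lambda>v. a (b v))"
      "endo (\<lambda>v. a (f (a v)))" "endo (\<lambda>v. b (f (a v)))" "endo (\<lambda>v. m (f (a v)))"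
      "endo (\<lambda>v. a (m v))" "endo (\<lambda>v. b (m v))" "endo (\<lambda>v. m (m v))"
      by (auto simp: endo_iff ls)
    show "a (a v) = a v" by (rule eq[OF c(1) a(1)]) (erule onE; simp add: BE ls)
    show "b (a v) = 0" by (rule eq[OF c(2) l(2)]) (erule onE; simp add: BE ls)
    show "m (a v) = 0" by (rule eq[OF c(3) l(2)]) (erule onE; simp add: BE ls)
    show "a (b v) = b v" by (rule eq[OF c(4) b(1)]) (erule onE; simp add: BE ls)
    show "a (f (a v)) = 0" by (rule eq[OF c(5) l(2)]) (erule onE; simp add: BE ls)
    show "b (f (a v)) = a v" by (rule eq[OF c(6) a(1)]) (erule onE; simp add: BE ls)
    show "m (f (a v)) = 0" by (rule eq[OF c(7) l(2)]) (erule onE; simp add: BE ls)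
    show "a (m v) = 0" by (rule eq[OF c(8) l(2)]) (erule onE; simp add: BE ls)
    show "b (m v) = 0" by (rule eq[OF c(9) l(2)]) (erule onE; simp add: BE ls)
    show "m (m v) = m v" by (rule eq[OF c(10) m(1)]) (erule onE; simp add: BE ls)
  qed
  moreover have "independent B" using ind by (rule independent_mono) auto
  moreover have "range a = span B"
  proof -
    have "span ((\<lambda>x. if x \<in> B then x else 0) ` E) = span B"
      using E(3) by (intro span_eq[THEN iffD2]) (auto intro: span_base span_zero rev_image_eqI)
    then show ?thesis using a(3) by simp
  qed
  moreover have "\<exists>l. m (f v) = l *s m v" if mv: "m v \<noteq> 0" for v
  proof -
    have m0: "m x = 0" if "x \<in> span (B \<union> f ` B)" for x
    proof -
      have "m x = (\<lambda>v. 0) x"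
        by (rule endo_eq_on_span[OF m(1) l(2) _ that]) (use BE in auto)
      then show ?thesis .
    qed
    then have "v \<notin> span (B \<union> f ` B)" using mv by blast
    then obtain l where "f v - l *s v \<in> span (B \<union> f ` B)"
      using max span_breakdown_eq by blast
    then have "m (f v) = l *s m v" using m0 by (fastforce simp: ls)
    then show ?thesis by blast
  qed
  ultimately show ?thesis by (rule that)
qed

section \<open>Solving the conditions on the coefficients over every field\<close>

lemma shifts_diagonal: "shifts 0 0"
  unfolding shifts_def by (intro exI[of _ 1] exI[of _ "-1"]) simp

lemma shifts_pair: "\<alpha> \<noteq> 0 \<Longrightarrow> \<gamma> \<noteq> 0 \<Longrightarrow> shifts \<alpha> \<gamma>"
  unfolding shifts_def by blast

text \<open>A third element leaves some \<open>x\<close> other than 0 and \<open>d\<close>, and then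
  \<open>d = x + (d - x)\<close> has nonzero summands.\<close>

lemma shifts_large_field:
  fixes y :: 'a
  assumes "y \<noteq> 0" "y \<noteq> 1"
  shows "shifts 0 d"
proof -
  have "\<exists>x. x \<noteq> 0 \<and> x \<noteq> d" using assms by (metis zero_neq_one)
  then obtain x where "x \<noteq> 0" "x \<noteq> d" by blast
  then show ?thesis
    unfolding shifts_def by (intro exI[of _ x] exI[of _ "d - x"]) auto
qed

lemma two_element_field:
  assumes "\<And>x :: 'a. x = 0 \<or> x = 1"
  shows "(1 :: 'a) + 1 = 0"
  using assms[of "1 + 1"] by (metis add_cancel_left_left zero_neq_one)

text \<open>Supplies the coefficients when \<open>S\<close> and the block on M are both scalars. The
  choice \<open>\<epsilon> = 0\<close> works unless \<open>s\<close> and \<open>t\<close> are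
  distinct and nonzero; in that case the field has a third element and \<open>\<epsilon>\<close> is
  unrestricted.\<close>

lemma shifts_two_scalars:
  fixes s t :: 'a
  obtains \<epsilon> \<beta> \<sigma> q where "shifts 0 \<epsilon>" "\<beta> \<noteq> 0" "\<sigma> * \<sigma> = \<sigma>" "q * q = q"
    "s = \<epsilon> + \<beta> * \<sigma>" "t = \<epsilon> + \<beta> * q"
proof -
  consider "s = 0" "t = 0" | "s \<noteq> 0" "t = 0" | "t \<noteq> 0" "s = 0 \<or> s = t"
    | "s \<noteq> 0" "t \<noteq> 0" "s \<noteq> t" by blast
  then show ?thesis
  proof cases
    case 1 show ?thesis by (rule that[of 0 1 0 0]) (use 1 shifts_diagonal in auto)
  next
    case 2 show ?thesis by (rule that[of 0 s 1 0]) (use 2 shifts_diagonal in auto)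
  next
    case 3
    show ?thesis
      by (rule that[of 0 t "if s = 0 then 0 else 1" 1]) (use 3 shifts_diagonal in auto)
  next
    case 4
    then have "\<exists>y::'a. y \<noteq> 0 \<and> y \<noteq> 1" by metis
    then have "shifts 0 s" using shifts_large_field by blast
    then show ?thesis by (rule that[of s "t - s" 0 1]) (use 4 in auto)
  qed
qed

text \<open>
  In the next two lemmas \<open>\<nu>\<close> stands for the trace of the identity of a hyperplane of \<open>K\<close> or of \<open>K\<close>, as an
  element of the field. The alternatives correspond to idempotents of ranks differing by one, which
  is what makes the condition solvable over the field with two elements.
\<close>

lemma shifts_trace_condition:
  fixes t \<nu> l :: 'a
  obtains \<epsilon> \<beta> q where "shifts 0 \<epsilon>" "\<beta> \<noteq> 0" "q * q = q" "l = \<epsilon> + \<beta> * q"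
    "t = (\<epsilon> + \<beta>) * (1 + \<nu>) \<or> t = \<epsilon> + (\<epsilon> + \<beta>) * \<nu>"
proof (cases "\<exists>y::'a. y \<noteq> 0 \<and> y \<noteq> 1")
  case True
  then have sh: "shifts 0 d" for d using shifts_large_field by blast
  consider "1 + \<nu> = 0" "t = 0" | "1 + \<nu> = 0" "t \<noteq> 0" | "1 + \<nu> \<noteq> 0" "t / (1 + \<nu>) = l"
    | "1 + \<nu> \<noteq> 0" "t / (1 + \<nu>) \<noteq> l" by blast
  then show ?thesis
  proof cases
    case 1 show ?thesis by (rule that[of l 1 0]) (use 1 sh in auto)
  next
    case 2
    \<comment> \<open>The first alternative would force \<open>t = 0\<close>; the second one reads
      \<open>t = - \<beta>\<close>.\<close>
    then have "\<nu> = -1" by (simp add: add_eq_0_iff)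
    then show ?thesis by (intro that[of l "- t" 0]) (use 2 sh in auto)
  next
    case 3 show ?thesis by (rule that[of "l - 1" 1 1]) (use 3 sh in \<open>auto simp: field_simps\<close>)
  next
    case 4
    show ?thesis
      by (rule that[of l "t / (1 + \<nu>) - l" 0]) (use 4 sh in \<open>auto simp: field_simps\<close>)
  qed
next
  case False
  then have F: "x = 0 \<or> x = 1" for x :: 'a by blast
  have 2: "(1::'a) + 1 = 0" using two_element_field F by blast
  have "l * l = l" using F[of l] by auto
  \<comment> \<open>For \<open>\<epsilon> = 0\<close> and \<open>\<beta> = 1\<close> the right-hand
    sides of the alternatives are \<open>1 + \<nu>\<close> and \<open>\<nu>\<close>, which exhaust
    the field with two elements.\<close>
  moreover have "t = 1 + \<nu> \<or> t = \<nu>" using F[of t] F[of \<nu>] 2 by auto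
  ultimately show ?thesis by (intro that[of 0 1 l]) (use shifts_diagonal in auto)
qed

lemma shifts_odd_trace_condition:
  fixes u \<nu> :: 'a
  obtains d0 d1 \<beta> where "shifts d0 d1" "\<beta> \<noteq> 0" "u = d1 + \<beta> + (d0 + d1 + \<beta>) * \<nu>"
proof (cases "u = 1 + \<nu>")
  case True
  show ?thesis by (rule that[of 0 0 1]) (use True shifts_diagonal in auto)
next
  case ne: False
  show ?thesis
  proof (cases "\<exists>y::'a. y \<noteq> 0 \<and> y \<noteq> 1")
    case True
    then have sh: "shifts 0 d" for d using shifts_large_field by blast
    show ?thesis
    proof (cases "1 + \<nu> = 0")
      case False
      define w where "w = u / (1 + \<nu>)"
      have "u = w * (1 + \<nu>)" using False by (simp add: w_def)
      then show ?thesis by (intro that[of 0 "w - 1" 1]) (use sh in \<open>auto simp: algebra_simps\<close>)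
    next
      case True
      \<comment> \<open>The condition becomes \<open>u = - d0\<close>, and \<open>ne\<close> makes
        \<open>- u\<close> nonzero, as \<open>shifts_pair\<close> requires.\<close>
      then have "\<nu> = -1" by (simp add: add_eq_0_iff)
      then show ?thesis
        by (intro that[of "- u" 1 1] shifts_pair) (use ne in auto)
    qed
  next
    case False
    then have F: "x = 0 \<or> x = 1" for x :: 'a by blast
    have 2: "(1::'a) + 1 = 0" using two_element_field F by blast
    have "u = \<nu>" using ne F[of u] F[of \<nu>] 2 by auto
    then show ?thesis
      by (intro that[of 1 1 1] shifts_pair) (use 2 in \<open>auto simp: distrib_right\<close>)
  qed
qed

end

section \<open>The cases: K finite or infinite, K + f K invariant or not\<close>

context splitting
begin

context
  fixes B :: "'b set"
  assumes B: "independent B" and aB: "range a = span B"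
begin

lemma a_fixed_iff: "a v = v \<longleftrightarrow> v \<in> span B"
  using aB aa by (metis rangeE rangeI)

lemma a_on_span: "v \<in> span B \<Longrightarrow> a v = v"
  using a_fixed_iff by blast

lemma in_span: "a v \<in> span B" "b v \<in> span B"
  using aB a_fixed_iff ab by auto

lemma endo_S: "endo (\<lambda>v. b (f (f v)))"
  by (simp add: endo_iff f_simps b_simps)

text \<open>The criterion for invariant K + f K: the maps between K and M vanish, and the scalar
  block on M is matched by \<open>q\<close>, which is 0 or 1. What remains is an equation on K
  alone.\<close>

lemma three_idempotents_if_commutator:
  assumes maps: "endo C" "endo R" "endo \<sigma>"
    and K: "range C \<subseteq> span B" "range R \<subseteq> span B" "range \<sigma> \<subseteq> span B"
    and \<sigma>: "\<And>v. \<sigma> (\<sigma> v) = \<sigma> v" "\<And>v. \<sigma> (R v) = R v"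
    and d: "shifts 0 \<epsilon>" and \<beta>: "\<beta> \<noteq> 0"
    and S: "\<And>v. v \<in> span B \<Longrightarrow> b (f (f v)) = \<epsilon> *s v + \<beta> *s (\<sigma> v + C (R v) - R (C v))"
    and W: "\<And>v. v \<in> span B \<Longrightarrow> m (f (f v)) = 0"
    and L: "\<And>v. m v = v \<Longrightarrow> m (f v) = l *s v" "l = \<epsilon> + \<beta> * q" "q * q = q"
  shows "three_idempotents f"
proof (rule three_idempotentsI[OF maps(1-3), where c = "\<lambda>v. 0" and \<rho> = "\<lambda>v. 0"
      and q = "\<lambda>v. q *s m v" and \<beta> = \<beta>])
  show "a (C v) = C v" "a (R v) = R v" "a (\<sigma> v) = \<sigma> v" for v
    using K a_fixed_iff by auto
  show "b (f (f v)) = (0 + \<epsilon>) *s v + \<beta> *s (\<sigma> v + C (R v) - R (C v) + 0)" if "a v = v" for v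
    using S that a_fixed_iff by simp
  show "m (f (f v)) = - (\<beta> *s 0)" if "a v = v" for v
    using W that a_fixed_iff by simp
  show "m (f v) = \<epsilon> *s v + \<beta> *s (q *s m v - 0)" if "m v = v" for v
    using L(1)[OF that] L(2) that by (simp add: algebra_simps)
qed (use \<sigma> d \<beta> L(3) in \<open>auto simp: endo_iff m_simps a_simps mm algebra_simps scale_scale\<close>)

text \<open>With \<open>\<epsilon> = 0\<close> and the identity of K as \<open>\<sigma>\<close>, the
  map \<open>S / \<beta> - 1\<close> has to be a commutator. The shift achieves this for every
  \<open>S\<close>, so \<open>\<beta>\<close> can be chosen to suit \<open>l\<close> alone.\<close>

lemma three_idempotents_infinite:
  assumes inf: "infinite B" and W: "\<And>v. v \<in> span B \<Longrightarrow> m (f (f v)) = 0"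
    and L: "\<And>v. m v = v \<Longrightarrow> m (f v) = l *s v"
  shows "three_idempotents f"
proof -
  obtain \<beta> q where \<beta>: "\<beta> \<noteq> 0" "l = 0 + \<beta> * q" "q * q = q"
  proof (cases "l = 0")
    case True show ?thesis by (rule that[of 1 0]) (use True in auto)
  next
    case False show ?thesis by (rule that[of l 1]) (use False in auto)
  qed
  obtain s where s: "endo s" "range s \<subseteq> span B"
    and comm: "\<forall>T. endo T \<longrightarrow> T ` span B \<subseteq> span B \<longrightarrow>
      (\<exists>W. endo W \<and> range W \<subseteq> span B \<and> (\<forall>v\<in>span B. T v = s (W v) - W (s v)))"
    by (rule shift_commutator[OF inf B]) (rule that)
  define T where "T v = inverse \<beta> *s b (f (f v)) - v" for v
  have "endo T" unfolding T_def by (simp add: endo_iff f_simps b_simps algebra_simps)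
  have "T ` span B \<subseteq> span B"
    using in_span by (auto simp: T_def intro!: span_diff span_scale)
  then obtain W where W': "endo W" "range W \<subseteq> span B"
    "\<And>v. v \<in> span B \<Longrightarrow> T v = s (W v) - W (s v)"
    using comm[rule_format, of T] \<open>endo T\<close> by blast
  show ?thesis
  proof (rule three_idempotents_if_commutator[OF s(1) W'(1) a s(2) W'(2) _ _ _ shifts_diagonal \<beta>(1) _ W L \<beta>(2,3)])
    fix v assume v: "v \<in> span B"
    have "\<beta> *s (v + T v) = b (f (f v))" using \<beta>(1) by (simp add: T_def algebra_simps)
    then show "b (f (f v)) = 0 *s v + \<beta> *s (a v + s (W v) - W (s v))"
      using W'(3)[OF v] a_on_span[OF v] by (simp add: add_diff_eq)
  qed (use in_span aa W'(2) a_on_span[OF subsetD[OF W'(2) rangeI]] in auto)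
qed

text \<open>A scalar \<open>S\<close> preserves every hyperplane, so it has no row of the kind used
  for nonscalar \<open>S\<close>. It needs no commutator: \<open>C = R = 0\<close>, and
  \<open>\<sigma>\<close> is 0 or the identity of K.\<close>

lemma three_idempotents_scalar:
  assumes S: "\<And>v. v \<in> span B \<Longrightarrow> b (f (f v)) = s *s v"
    and W: "\<And>v. v \<in> span B \<Longrightarrow> m (f (f v)) = 0"
    and L: "\<And>v. m v = v \<Longrightarrow> m (f v) = l *s v"
  shows "three_idempotents f"
proof -
  obtain \<epsilon> \<beta> \<sigma> q where e: "shifts 0 \<epsilon>" "\<beta> \<noteq> 0" "\<sigma> * \<sigma> = \<sigma>" "q * q = q"
    "s = \<epsilon> + \<beta> * \<sigma>" "l = \<epsilon> + \<beta> * q"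
    by (rule shifts_two_scalars[of s l]) (rule that)
  have z: "endo (\<lambda>v. 0)" and \<sigma>: "endo (\<lambda>v. \<sigma> *s a v)" by (auto simp: endo_iff a_simps algebra_simps)
  show ?thesis
  proof (rule three_idempotents_if_commutator[OF z z \<sigma> _ _ _ _ _ e(1,2) _ W L e(6,4)])
    fix v assume v: "v \<in> span B"
    then show "b (f (f v)) = \<epsilon> *s v + \<beta> *s (\<sigma> *s a v + 0 - 0)"
      using S[OF v] a_on_span[OF v] e(5) by (simp add: algebra_simps)
  qed (use in_span e(3) in \<open>auto simp: a_simps aa span_zero span_scale\<close>)
qed

text \<open>
  The space \<open>K\<close> is the sum of a hyperplane \<open>span B1\<close> and the line of \<open>e\<close>, chosen so that the \<open>e\<close>-row \<open>r\<close>
  of \<open>S\<close> does not vanish on the hyperplane. The commutator lemma is applied on the hyperplane with this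
  row, so that the rank one correction can be absorbed by the \<open>e\<close>-rows and columns of \<open>C\<close> and \<open>R\<close>.
\<close>

lemma three_idempotents_nonscalar:
  assumes fin: "finite B" and k1: "k1 \<in> span B" "\<And>l. b (f (f k1)) \<noteq> l *s k1"
    and W: "\<And>v. v \<in> span B \<Longrightarrow> m (f (f v)) = 0"
    and L: "\<And>v. m v = v \<Longrightarrow> m (f v) = l *s v"
  shows "three_idempotents f"
proof -
  define S where "S v = b (f (f v))" for v
  have S: "endo S" using endo_S by (simp add: S_def[abs_def])
  note Ss = endo_simps[OF S]
  have SB: "S v \<in> span B" for v using in_span by (simp add: S_def)
  \<comment> \<open>With \<open>e = S k1\<close> and \<open>k1\<close> in the hyperplane, the row
    \<open>r\<close> takes the value 1 at \<open>k1\<close>.\<close>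
  define e where "e = S k1"
  have "k1 \<noteq> 0" using k1(2)[of 0] by (auto simp: f_simps b_simps)
  have "e \<notin> span {k1}" using k1(2) by (auto simp: e_def S_def span_singleton)
  then have "independent {e, k1}" "e \<noteq> k1"
    using \<open>k1 \<noteq> 0\<close> by (auto simp: independent_insert span_base)
  then obtain B' where B': "{e, k1} \<subseteq> B'" "B' \<subseteq> span B" "independent B'" "span B \<subseteq> span B'"
    using maximal_independent_subset_extend[of "{e, k1}" "span B"] k1(1) SB by (auto simp: e_def)
  define B1 where "B1 = B' - {e}"
  have B1: "independent B1" "finite B1" "k1 \<in> B1" "B' = insert e B1"
    using B' independent_span_bound[OF fin B'(3)] \<open>e \<noteq> k1\<close> independent_mono[OF B'(3)]
    by (auto simp: B1_def)
  have B1B: "span B1 \<subseteq> span B"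
    using B'(2) by (intro span_minimal) (auto simp: B1_def)
  have eB: "e \<in> span B" using SB by (simp add: e_def)
  obtain \<phi> where \<phi>: "functional \<phi>" "\<And>x. x \<in> B' \<Longrightarrow> \<phi> x = (if x = e then 1 else 0)"
    by (rule functional_extend[OF B'(3)]) (rule that)
  note \<phi>s = functional_simps[OF \<phi>(1)]
  have \<phi>e: "\<phi> e = 1" using \<phi>(2) B1(4) by simp
  have \<phi>1: "\<phi> x = 0" if "x \<in> span B1" for x
  proof -
    have "span B1 \<subseteq> {x. \<phi> x = 0}"
    proof (rule span_minimal)
      show "B1 \<subseteq> {x. \<phi> x = 0}" using \<phi>(2) by (auto simp: B1_def)
      show "subspace {x. \<phi> x = 0}" by (auto simp: subspace_def \<phi>s)
    qed
    then show ?thesis using that by blast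
  qed
  define \<pi> where "\<pi> v = a v - \<phi> (a v) *s e" for v
  have \<pi>: "endo \<pi>" unfolding \<pi>_def by (simp add: endo_iff \<phi>s a_simps algebra_simps)
  note \<pi>s = endo_simps[OF \<pi>]
  have \<pi>B1: "\<pi> v \<in> span B1" for v
  proof -
    have "endo (\<lambda>v. v - \<phi> v *s e)" by (simp add: endo_iff \<phi>s algebra_simps)
    then have "a v - \<phi> (a v) *s e \<in> span B1"
    proof (rule endo_span_range)
      show "a v \<in> span B'" using in_span B'(4) by blast
      show "x - \<phi> x *s e \<in> span B1" if "x \<in> B'" for x
        using that \<phi>(2)[OF that] by (cases "x = e") (auto simp: B1_def span_zero intro: span_base)
    qed
    then show ?thesis by (simp add: \<pi>_def)
  qed
  have a1: "a x = x" if "x \<in> span B1" for x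
    using that B1B a_on_span by auto
  have ae: "a e = e" using eB a_on_span by simp
  have \<pi>1: "\<pi> x = x" if "x \<in> span B1" for x
    using that by (simp add: \<pi>_def a1 \<phi>1)
  have \<pi>e: "\<pi> e = 0" by (simp add: \<pi>_def ae \<phi>e)
  have dec: "v = \<pi> v + \<phi> (a v) *s e" if "v \<in> span B" for v
    using a_on_span[OF that] by (simp add: \<pi>_def)
  have \<phi>a\<pi>: "\<phi> (a (\<pi> v)) = 0" for v
    using \<pi>B1 by (simp add: a1 \<phi>1)
  define r where "r v = \<phi> (S v)" for v
  have r: "functional r" unfolding r_def by (simp add: functional_iff \<phi>s Ss)
  have "\<exists>x\<in>span B1. r x \<noteq> 0"
    using B1(3) \<phi>e by (intro bexI[of _ k1]) (auto simp: r_def e_def[symmetric] span_base)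
  then obtain s \<rho> where s: "endo s" "functional \<rho>" "s ` span B1 = span B1"
    "\<And>v. v \<in> span B1 \<Longrightarrow> \<rho> (s v) = r v"
    and comm: "\<forall>T. endo T \<longrightarrow> T ` span B1 \<subseteq> span B1 \<longrightarrow>
      (\<exists>W c. endo W \<and> range W \<subseteq> span B1 \<and> c \<in> span B1 \<and>
        (\<forall>v\<in>span B1. T v = s (W v) - W (s v) + \<rho> v *s c))"
    by (rule cyclic_commutator[OF B1(2,1) r]) (rule that)
  note ss = endo_simps[OF s(1)] and \<rho>s = functional_simps[OF s(2)]
  have sB1: "s x \<in> span B1" if "x \<in> span B1" for x using s(3) that by blast
  have "endo (\<lambda>v. \<pi> (S v))" by (simp add: endo_iff \<pi>s Ss)
  then obtain V1 c1 where V1: "endo V1" "range V1 \<subseteq> span B1" "c1 \<in> span B1"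
    "\<And>v. v \<in> span B1 \<Longrightarrow> \<pi> (S v) = s (V1 v) - V1 (s v) + \<rho> v *s c1"
    using comm[rule_format, of "\<lambda>v. \<pi> (S v)"] \<pi>B1 by blast
  have "endo (\<lambda>v. v)" by (simp add: endo_iff)
  then obtain V2 c2 where V2: "endo V2" "range V2 \<subseteq> span B1" "c2 \<in> span B1"
    "\<And>v. v \<in> span B1 \<Longrightarrow> v = s (V2 v) - V2 (s v) + \<rho> v *s c2"
    using comm[rule_format, of "\<lambda>v. v"] by blast
  obtain \<epsilon> \<beta> q where e: "shifts 0 \<epsilon>" "\<beta> \<noteq> 0" "q * q = q" "l = \<epsilon> + \<beta> * q"
    and tr: "\<phi> (S e) + \<rho> c1 = (\<epsilon> + \<beta>) * (1 + \<rho> c2) \<or>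
      \<phi> (S e) + \<rho> c1 = \<epsilon> + (\<epsilon> + \<beta>) * \<rho> c2"
    by (rule shifts_trace_condition[of l "\<phi> (S e) + \<rho> c1" "\<rho> c2"]) (rule that)
  \<comment> \<open>\<open>V1\<close> and \<open>c1\<close> represent the compression of
    \<open>S\<close> to the hyperplane, \<open>V2\<close> and \<open>c2\<close> the identity there.
    So \<open>G\<close> and \<open>d\<close> represent the compression of \<open>S\<close> minus
    \<open>\<epsilon> + \<beta>\<close>.\<close>
  define G where "G v = V1 v - (\<epsilon> + \<beta>) *s V2 v" for v
  define d where "d = c1 - (\<epsilon> + \<beta>) *s c2"
  have G: "endo G" unfolding G_def by (simp add: endo_iff endo_simps[OF V1(1)] endo_simps[OF V2(1)] algebra_simps)
  note Gs = endo_simps[OF G]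
  have GB1: "G v \<in> span B1" for v
    unfolding G_def using V1(2) V2(2) by (auto intro!: span_diff span_scale)
  have dB1: "d \<in> span B1" unfolding d_def using V1(3) V2(3) by (auto intro!: span_diff span_scale)
  have \<rho>d: "\<rho> d = \<rho> c1 - (\<epsilon> + \<beta>) * \<rho> c2" by (simp add: d_def \<rho>s)
  have S1: "S x = (\<epsilon> + \<beta>) *s x + (s (G x) - G (s x) + \<rho> x *s d) + r x *s e" if "x \<in> span B1" for x
  proof -
    have "S x = \<pi> (S x) + r x *s e" using dec[OF SB, of x] a_on_span[OF SB] by (simp add: r_def)
    moreover have "\<pi> (S x) = (\<epsilon> + \<beta>) *s x + (s (G x) - G (s x) + \<rho> x *s d)"
    proof -
      have "(\<epsilon> + \<beta>) *s x = (\<epsilon> + \<beta>) *s (s (V2 x) - V2 (s x) + \<rho> x *s c2)"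
        using V2(4)[OF that] by simp
      then show ?thesis
        using V1(4)[OF that] by (simp add: G_def d_def ss algebra_simps)
    qed
    ultimately show ?thesis by simp
  qed
  define u where "u = \<pi> (S e)"
  have u: "u \<in> span B1" using \<pi>B1 by (simp add: u_def)
  define h where "h = \<phi> (S e)"
  have Se: "S e = u + h *s e" unfolding h_def using dec[OF SB, of e] a_on_span[OF SB] by (simp add: u_def)
  have Sv: "S v = S (\<pi> v) + \<phi> (a v) *s S e" if "v \<in> span B" for v
    using arg_cong[OF dec[OF that], of S] by (simp add: Ss)
  define i where "i = inverse \<beta>"
  have "\<beta> * i = 1" using e(2) by (simp add: i_def)
  then have i: "\<beta> * i = 1" "\<beta> * (i * z) = z" for z by (simp_all flip: mult.assoc)
  show ?thesis
    using tr
  proof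
    assume tr: "\<phi> (S e) + \<rho> c1 = (\<epsilon> + \<beta>) * (1 + \<rho> c2)"
    \<comment> \<open>In blocks for the hyperplane and \<open>e\<close>, \<open>C\<close> will have
      the rows \<open>(-s, d)\<close>, \<open>(0, 0)\<close> and \<open>\<beta> R\<close> the rows
      \<open>(-G, x)\<close>, \<open>(\<rho>, 0)\<close>. As \<open>s\<close> maps onto the
      hyperplane, \<open>x\<close> can be chosen to give the \<open>e\<close>-column
      \<open>u\<close>; the corner entry is settled by the trace condition.\<close>
    have "G d - u \<in> s ` span B1" using s(3) GB1 u by (auto intro: span_diff)
    then obtain x where x: "x \<in> span B1" "s x = G d - u" by auto
    define C where "C v = \<phi> (a v) *s d - s (\<pi> v)" for v
    define R where "R v = i *s (\<phi> (a v) *s x + \<rho> (\<pi> v) *s e - G (\<pi> v))" for v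
    have C: "endo C" unfolding C_def by (simp add: endo_iff \<phi>s a_simps ss \<pi>s algebra_simps)
    have R: "endo R" unfolding R_def by (simp add: endo_iff \<phi>s a_simps \<rho>s Gs \<pi>s algebra_simps)
    have rC: "range C \<subseteq> span B"
      using dB1 sB1 \<pi>B1 B1B by (auto simp: C_def intro!: span_diff span_scale)
    have rR: "range R \<subseteq> span B"
      using x GB1 B1B eB by (auto simp: R_def intro!: span_diff span_add span_scale)
    show ?thesis
    proof (rule three_idempotents_if_commutator[OF C R a rC rR _ _ _ e(1,2) _ W L e(4,3)])
      fix v assume v: "v \<in> span B"
      define y where "y = \<pi> v"
      define k where "k = \<phi> (a v)"
      have y: "y \<in> span B1" using \<pi>B1 by (simp add: y_def)
      have piR: "\<pi> (R v) = i *s (k *s x - G y)" "\<phi> (a (R v)) = i * \<rho> y"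
        using y x GB1 by (simp_all add: R_def \<pi>s \<pi>e \<pi>1 a_simps ae a1 \<phi>s \<phi>1 \<phi>e y_def k_def)
      have piC: "\<pi> (C v) = k *s d - s y" "\<phi> (a (C v)) = 0"
        using y dB1 sB1 by (simp_all add: C_def \<pi>s \<pi>1 a_simps a1 \<phi>s \<phi>1 y_def k_def)
      have CR: "\<beta> *s C (R v) = \<rho> y *s d - k *s s x + s (G y)"
        by (simp add: C_def[of "R v"] piR ss algebra_simps i)
      have RC: "\<beta> *s R (C v) = (k * \<rho> d) *s e - r y *s e - k *s G d + G (s y)"
        by (simp add: R_def[of "C v"] piC \<rho>s s(4)[OF y] Gs algebra_simps i)
      have \<rho>d': "\<rho> d = \<epsilon> + \<beta> - h"
        using tr by (simp add: \<rho>d h_def algebra_simps)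
      have v': "v = y + k *s e" using dec[OF v] by (simp add: y_def k_def)
      have "b (f (f v)) = S y + k *s S e"
        using Sv[OF v] by (simp add: S_def y_def k_def)
      also have "\<dots> = \<epsilon> *s v + \<beta> *s v + \<beta> *s C (R v) - \<beta> *s R (C v)"
        unfolding CR RC \<rho>d' Se S1[OF y] x(2) by (simp add: v' algebra_simps)
      finally show "b (f (f v)) = \<epsilon> *s v + \<beta> *s (a v + C (R v) - R (C v))"
        using a_on_span[OF v] by (simp add: algebra_simps)
    qed (use in_span aa a_on_span[OF subsetD[OF rR rangeI]] in auto)
  next
    assume tr: "\<phi> (S e) + \<rho> c1 = \<epsilon> + (\<epsilon> + \<beta>) * \<rho> c2"
    \<comment> \<open>Here \<open>\<sigma>\<close> is a projection onto the hyperplane, which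
      contains the range of \<open>R\<close>, so its rank is one less than in the other alternative.
      Its \<open>e\<close>-column \<open>\<tau>\<close> supplies what the commutator lacks of
      \<open>u\<close>.\<close>
    define \<tau> where "\<tau> = i *s u - i *s G d"
    have \<tau>: "\<tau> \<in> span B1" unfolding \<tau>_def using u GB1 by (auto intro!: span_diff span_scale)
    define C where "C v = i *s (\<rho> (\<pi> v) *s e - G (\<pi> v))" for v
    define R where "R v = s (\<pi> v) - \<phi> (a v) *s d" for v
    define \<sigma> where "\<sigma> v = \<pi> v + \<phi> (a v) *s \<tau>" for v
    have C: "endo C" unfolding C_def by (simp add: endo_iff \<rho>s Gs \<pi>s algebra_simps)
    have R: "endo R" unfolding R_def by (simp add: endo_iff \<phi>s a_simps ss \<pi>s algebra_simps)
    have \<sigma>: "endo \<sigma>" unfolding \<sigma>_def by (simp add: endo_iff \<phi>s a_simps \<pi>s algebra_simps)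
    have RB1: "R v \<in> span B1" for v
      using dB1 sB1 \<pi>B1 by (auto simp: R_def intro!: span_diff span_scale)
    have \<sigma>B1: "\<sigma> v \<in> span B1" for v
      using \<tau> \<pi>B1 by (auto simp: \<sigma>_def intro!: span_add span_scale)
    have \<sigma>1: "\<sigma> x = x" if "x \<in> span B1" for x
      using that by (simp add: \<sigma>_def \<pi>1 a1 \<phi>1)
    have rC: "range C \<subseteq> span B"
      using GB1 B1B eB by (auto simp: C_def intro!: span_diff span_scale)
    show ?thesis
    proof (rule three_idempotents_if_commutator[OF C R \<sigma> rC _ _ _ _ e(1,2) _ W L e(4,3)])
      fix v assume v: "v \<in> span B"
      define y where "y = \<pi> v"
      define k where "k = \<phi> (a v)"
      have y: "y \<in> span B1" using \<pi>B1 by (simp add: y_def)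
      have piC: "\<pi> (C v) = - (i *s G y)" "\<phi> (a (C v)) = i * \<rho> y"
        using y GB1 by (simp_all add: C_def \<pi>s \<pi>e \<pi>1 a_simps ae a1 \<phi>s \<phi>1 \<phi>e y_def)
      have Rv: "R v = s y - k *s d" by (simp add: R_def y_def k_def)
      have CR: "\<beta> *s C (R v) = r y *s e - (k * \<rho> d) *s e - G (s y) + k *s G d"
        unfolding C_def[of "R v"] \<pi>1[OF RB1] by (simp add: Rv \<rho>s s(4)[OF y] Gs algebra_simps i)
      have RC: "\<beta> *s R (C v) = - s (G y) - \<rho> y *s d"
        by (simp add: R_def[of "C v"] piC ss algebra_simps i)
      have \<sigma>v: "\<beta> *s \<sigma> v = \<beta> *s y + k *s u - k *s G d"
        by (simp add: \<sigma>_def y_def[symmetric] k_def[symmetric] \<tau>_def algebra_simps i)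
      have \<rho>d': "\<rho> d = \<epsilon> - h"
        using tr by (simp add: \<rho>d h_def algebra_simps)
      have v': "v = y + k *s e" using dec[OF v] by (simp add: y_def k_def)
      have "b (f (f v)) = S y + k *s S e"
        using Sv[OF v] by (simp add: S_def y_def k_def)
      also have "\<dots> = \<epsilon> *s v + \<beta> *s \<sigma> v + \<beta> *s C (R v) - \<beta> *s R (C v)"
        unfolding CR RC \<sigma>v \<rho>d' Se S1[OF y] by (simp add: v' algebra_simps)
      finally show "b (f (f v)) = \<epsilon> *s v + \<beta> *s (\<sigma> v + C (R v) - R (C v))"
        by (simp add: algebra_simps)
    qed (use RB1 \<sigma>B1 \<sigma>1 B1B in auto)
  qed
qed

text \<open>
  The case in which \<open>K + f K\<close> is not invariant and hence \<open>M\<close> is the line of \<open>z\<close>.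
\<close>

lemma three_idempotents_line:
  assumes k: "k \<in> span B" "z = m (f (f k))" "z \<noteq> 0"
    and line: "\<And>v. \<exists>x. m v = x *s z" and L: "m (f z) = l *s z"
  shows "three_idempotents f"
proof -
  have mz: "m z = z" using k(2) mm by simp
  have "independent {z}" using k(3) by simp
  then obtain \<zeta> where \<zeta>: "functional \<zeta>" "\<And>x. x \<in> {z} \<Longrightarrow> \<zeta> x = 1"
    by (rule functional_extend) (rule that)
  note \<zeta>s = functional_simps[OF \<zeta>(1)]
  have \<zeta>m: "m v = \<zeta> (m v) *s z" for v
    using line[of v] \<zeta>(2) by (auto simp: \<zeta>s)
  have Lm: "m (f v) = l *s v" if "m v = v" for v
    using line[of v] that L by (auto simp: f_simps m_simps algebra_simps)
  have q: "endo m" "\<And>v. m (m v) = m v" by (fact m mm)+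
  show ?thesis
  proof (cases "finite B")
    case False
    obtain s e where s: "endo s" "range s \<subseteq> span B" and e: "e \<in> span B"
      and comm: "\<forall>T. endo T \<longrightarrow> T ` span B \<subseteq> span B \<longrightarrow>
        (\<exists>W. endo W \<and> range W \<subseteq> span B \<and> (\<forall>v\<in>span B. T v = s (W v) - W (s v)))"
      and ext: "\<forall>g y. endo g \<longrightarrow> (\<exists>\<rho>. endo \<rho> \<and> (\<forall>v\<in>span B. \<rho> (s v) = g v) \<and> \<rho> e = y \<and>
        range \<rho> \<subseteq> span (insert y (range g)))"
      by (rule shift_commutator[OF False B]) (rule that)
    have g: "endo (\<lambda>v. - m (f (f v)))" by (simp add: endo_iff m_simps f_simps)
    \<comment> \<open>The values on the image of \<open>s\<close> are dictated by the hypothesis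
      \<open>W\<close> of the criterion with \<open>C = s\<close> and \<open>\<beta> = 1\<close>.
      The value at \<open>e\<close> is dictated by \<open>L\<close>, because \<open>c\<close> will
      send \<open>z\<close> to \<open>e\<close>.\<close>
    obtain \<rho> where \<rho>: "endo \<rho>" "\<And>v. v \<in> span B \<Longrightarrow> \<rho> (s v) = - m (f (f v))" "\<rho> e = (1 - l) *s z"
      "range \<rho> \<subseteq> span (insert ((1 - l) *s z) (range (\<lambda>v. - m (f (f v)))))"
      using ext[rule_format, OF g, of "(1 - l) *s z"] by blast
    have "span (insert ((1 - l) *s z) (range (\<lambda>v. - m (f (f v))))) \<subseteq> {x. m x = x}"
      by (rule span_minimal) (auto simp: mz m_simps mm subspace_def)
    then have m\<rho>: "m (\<rho> v) = \<rho> v" for v using \<rho>(4) by blast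
    define c where "c v = \<zeta> (m v) *s e" for v
    have c: "endo c" unfolding c_def by (simp add: endo_iff \<zeta>s m_simps algebra_simps)
    define T where "T v = b (f (f v)) - a v - c (\<rho> v)" for v
    have "endo T" unfolding T_def
      by (simp add: endo_iff f_simps b_simps a_simps endo_simps[OF c] endo_simps[OF \<rho>(1)] algebra_simps)
    moreover have "T ` span B \<subseteq> span B"
      using in_span e by (auto simp: T_def c_def intro!: span_diff span_scale)
    ultimately obtain W where W: "endo W" "range W \<subseteq> span B"
      "\<And>v. v \<in> span B \<Longrightarrow> T v = s (W v) - W (s v)"
      using comm[rule_format, of T] by blast
    have aW: "a (W v) = W v" and as: "a (s v) = s v" and ac: "a (c v) = c v" for v
      using W(2) s(2) a_on_span e by (auto simp: c_def a_simps)
    show ?thesis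
    proof (rule three_idempotentsI[OF s(1) W(1) a c \<rho>(1) q(1) as aW aa ac m\<rho> q(2) aa aW q(2) m\<rho>
          shifts_diagonal, where \<beta> = 1])
      show "b (f (f v)) = (0 + 0) *s v + 1 *s (a v + s (W v) - W (s v) + c (\<rho> v))" if "a v = v" for v
      proof -
        have "s (W v) - W (s v) = T v" using W(3) that a_fixed_iff by simp
        then show ?thesis by (simp add: T_def algebra_simps)
      qed
      show "m (f (f v)) = - (1 *s \<rho> (s v))" if "a v = v" for v
        using \<rho>(2) that a_fixed_iff by simp
      show "m (f v) = 0 *s v + 1 *s (m v - \<rho> (c v))" if "m v = v" for v
      proof -
        have "\<rho> (c v) = (1 - l) *s (\<zeta> (m v) *s z)"
          by (simp add: c_def endo_simps[OF \<rho>(1)] \<rho>(3) mult.commute)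
        also have "\<dots> = v - l *s v" using \<zeta>m[of v] that by (simp add: algebra_simps)
        finally show ?thesis using Lm[OF that] that by simp
      qed
    qed simp
  next
    case True
    define r where "r v = \<zeta> (m (f (f v)))" for v
    have r: "functional r" unfolding r_def by (simp add: functional_iff \<zeta>s m_simps f_simps)
    have "\<exists>x\<in>span B. r x \<noteq> 0" using k \<zeta>(2) by (intro bexI[of _ k]) (auto simp: r_def)
    then obtain s \<rho> where s: "endo s" "functional \<rho>" "s ` span B = span B"
      "\<And>v. v \<in> span B \<Longrightarrow> \<rho> (s v) = r v"
      and comm: "\<forall>T. endo T \<longrightarrow> T ` span B \<subseteq> span B \<longrightarrow>
        (\<exists>W c. endo W \<and> range W \<subseteq> span B \<and> c \<in> span B \<and>
          (\<forall>v\<in>span B. T v = s (W v) - W (s v) + \<rho> v *s c))"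
      by (rule cyclic_commutator[OF True B r]) (rule that)
    note ss = endo_simps[OF s(1)] and \<rho>s = functional_simps[OF s(2)]
    obtain V1 c1 where V1: "endo V1" "range V1 \<subseteq> span B" "c1 \<in> span B"
      "\<And>v. v \<in> span B \<Longrightarrow> b (f (f v)) = s (V1 v) - V1 (s v) + \<rho> v *s c1"
      using comm[rule_format, OF endo_S] in_span by blast
    have "endo (\<lambda>v. v)" by (simp add: endo_iff)
    then obtain V2 c2 where V2: "endo V2" "range V2 \<subseteq> span B" "c2 \<in> span B"
      "\<And>v. v \<in> span B \<Longrightarrow> v = s (V2 v) - V2 (s v) + \<rho> v *s c2"
      using comm[rule_format, of "\<lambda>v. v"] by blast
    \<comment> \<open>The equation amounts to \<open>\<rho> d' = d1 + \<beta> - l\<close>, which is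
      what the hypothesis \<open>L\<close> of the criterion demands on the line M.\<close>
    obtain d0 d1 \<beta> where d: "shifts d0 d1" "\<beta> \<noteq> 0"
      "l + \<rho> c1 = d1 + \<beta> + (d0 + d1 + \<beta>) * \<rho> c2"
      by (rule shifts_odd_trace_condition[of "l + \<rho> c1" "\<rho> c2"]) (rule that)
    define h where "h = d0 + d1 + \<beta>"
    define i where "i = inverse \<beta>"
    have "\<beta> * i = 1" using d(2) by (simp add: i_def)
    then have i: "\<beta> * i = 1" "\<beta> * (i * z) = z" for z by (simp_all flip: mult.assoc)
    define R where "R v = h *s V2 v - V1 v" for v
    define d' where "d' = c1 - h *s c2"
    define C where "C v = - (i *s s (a v))" for v
    define c where "c v = (i * \<zeta> (m v)) *s d'" for v
    define \<rho>' where "\<rho>' v = \<rho> (a v) *s z" for v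
    have R: "endo R" unfolding R_def
      by (simp add: endo_iff endo_simps[OF V1(1)] endo_simps[OF V2(1)] algebra_simps)
    have C: "endo C" unfolding C_def by (simp add: endo_iff ss a_simps algebra_simps)
    have c: "endo c" unfolding c_def by (simp add: endo_iff \<zeta>s m_simps algebra_simps)
    have \<rho>': "endo \<rho>'" unfolding \<rho>'_def by (simp add: endo_iff \<rho>s a_simps algebra_simps)
    have dB: "d' \<in> span B" unfolding d'_def using V1(3) V2(3) by (auto intro!: span_diff span_scale)
    have aR: "a (R v) = R v" for v
      using a_on_span[OF subsetD[OF V1(2) rangeI]] a_on_span[OF subsetD[OF V2(2) rangeI]]
      by (simp add: R_def a_simps)
    have sa: "s (a v) \<in> span B" for v using s(3) in_span(1) by blast
    have aC: "a (C v) = C v" for v by (simp add: C_def a_simps a_on_span[OF sa])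
    have ac: "a (c v) = c v" for v by (simp add: c_def a_simps a_on_span[OF dB])
    have m\<rho>: "m (\<rho>' v) = \<rho>' v" for v by (simp add: \<rho>'_def m_simps mz)
    show ?thesis
    proof (rule three_idempotentsI[OF C R a c \<rho>' q(1) aC aR aa ac m\<rho> q(2) aa aR q(2) m\<rho> d(1,2)])
      fix v assume av: "a v = v"
      then have v: "v \<in> span B" using a_fixed_iff by simp
      have CR: "\<beta> *s C (R v) = s (V1 v) - h *s s (V2 v)"
        by (simp add: C_def aR) (simp add: R_def ss algebra_simps i)
      have RC: "\<beta> *s R (C v) = V1 (s v) - h *s V2 (s v)"
        by (simp add: C_def av R_def endo_simps[OF V1(1)] endo_simps[OF V2(1)] algebra_simps i)
      have c\<rho>: "\<beta> *s c (\<rho>' v) = \<rho> v *s c1 - h *s (\<rho> v *s c2)"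
        by (simp add: c_def \<rho>'_def d'_def av m_simps mz \<zeta>s \<zeta>(2) algebra_simps i)
      have "h *s v = h *s (s (V2 v) - V2 (s v) + \<rho> v *s c2)" using V2(4)[OF v] by simp
      then have "b (f (f v)) = h *s v + \<beta> *s C (R v) - \<beta> *s R (C v) + \<beta> *s c (\<rho>' v)"
        unfolding CR RC c\<rho> V1(4)[OF v] by (simp add: algebra_simps)
      then show "b (f (f v)) = (d0 + d1) *s v + \<beta> *s (a v + C (R v) - R (C v) + c (\<rho>' v))"
        by (simp add: av h_def algebra_simps)
      have "m (f (f v)) = r v *s z" using \<zeta>m[of "f (f v)"] by (simp add: r_def)
      then show "m (f (f v)) = - (\<beta> *s \<rho>' (C v))"
        by (simp add: \<rho>'_def aC) (simp add: C_def av \<rho>s s(4)[OF v] i)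
    next
      fix v assume mv: "m v = v"
      have \<rho>d: "\<rho> d' = d1 + \<beta> - l" using d(3) by (simp add: d'_def h_def \<rho>s algebra_simps)
      have "\<beta> *s \<rho>' (c v) = \<rho> d' *s (\<zeta> (m v) *s z)"
        by (simp add: \<rho>'_def ac) (simp add: c_def \<rho>s algebra_simps i)
      also have "\<dots> = (d1 + \<beta> - l) *s v" using \<zeta>m[of v] mv unfolding \<rho>d by simp
      finally show "m (f v) = d1 *s v + \<beta> *s (m v - \<rho>' (c v))"
        using Lm[OF mv] mv by (simp add: algebra_simps)
    qed
  qed
qed

lemma three_idempotents_if_maximal:
  assumes eig: "\<And>v. m v \<noteq> 0 \<Longrightarrow> \<exists>l. m (f v) = l *s m v"
  shows "three_idempotents f"
proof (cases "\<forall>v\<in>span B. m (f (f v)) = 0")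
  case True
  have "endo (\<lambda>v. m (f v))" by (simp add: endo_iff m_simps f_simps)
  moreover have "subspace {v. m v = v}" by (auto simp: subspace_def m_simps)
  moreover have "\<exists>l. m (f v) = l *s v" if "v \<in> {v. m v = v}" for v
    using eig[of v] that by (cases "v = 0") (auto simp: f_simps m_simps)
  ultimately have "\<exists>l. \<forall>v\<in>{v. m v = v}. m (f v) = l *s v"
    by (rule scalar_if_all_eigenvectors)
  then obtain l where L: "\<And>v. m v = v \<Longrightarrow> m (f v) = l *s v" by blast
  show ?thesis
  proof (cases "infinite B")
    case inf: True
    then show ?thesis using three_idempotents_infinite True L by blast
  next
    case fin: False
    show ?thesis
    proof (cases "\<exists>s. \<forall>v\<in>span B. b (f (f v)) = s *s v")
      case True
      then show ?thesis using three_idempotents_scalar \<open>\<forall>v\<in>span B. m (f (f v)) = 0\<close> L by blast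
    next
      case False
      then have "\<not> (\<forall>v\<in>span B. \<exists>l. b (f (f v)) = l *s v)"
        using scalar_if_all_eigenvectors[OF endo_S subspace_span] by blast
      then obtain k1 where "k1 \<in> span B" "\<And>l. b (f (f k1)) \<noteq> l *s k1" by blast
      then show ?thesis using three_idempotents_nonscalar fin True L by blast
    qed
  qed
next
  case False
  then obtain k where k: "k \<in> span B" "m (f (f k)) \<noteq> 0" by blast
  define z where "z = m (f (f k))"
  have ak: "a k = k" using k(1) by (rule a_on_span)
  have mfk: "m (f k) = 0" using a_fixed[OF ak] by simp
  have "\<exists>x. m v = x *s z" for v
  proof (cases "m v = 0")
    case True
    then show ?thesis by (intro exI[of _ 0]) simp
  next
    case False
    obtain l where l: "m (f v) = l *s m v" using eig[OF False] by blast
    \<comment> \<open>Adding \<open>f k\<close> leaves \<open>m v\<close> unchanged but changes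
      \<open>m (f v)\<close> by \<open>z\<close>. Comparing the two eigenvalues makes
      \<open>z\<close> a multiple of \<open>m v\<close>.\<close>
    have "m (v + f k) = m v" by (simp add: m_simps mfk)
    then obtain l' where l': "m (f (v + f k)) = l' *s m v" using eig[of "v + f k"] False by auto
    have z: "z = (l' - l) *s m v" using l l' by (simp add: z_def f_simps m_simps algebra_simps)
    then have "l' - l \<noteq> 0" using k(2) by (auto simp: z_def)
    then have "m v = inverse (l' - l) *s z" using z by simp
    then show ?thesis by blast
  qed
  moreover obtain l where "m (f z) = l *s z"
    using eig[of z] k(2) by (auto simp: z_def mm)
  ultimately show ?thesis
    using three_idempotents_line[OF k(1) z_def] k(2) by (auto simp: z_def)
qed

end

end

theorem theorem7:
  fixes scale :: "'a::field \<Rightarrow> 'b::ab_group_add \<Rightarrow> 'b"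
    and f :: "'b \<Rightarrow> 'b"
  assumes "vector_space scale"
    and "Vector_Spaces.linear scale scale f"
  shows "\<exists>(c1::'a) (c2::'a) (c3::'a) e1 e2 e3.
           idempotent_endo scale e1 \<and> idempotent_endo scale e2 \<and> idempotent_endo scale e3 \<and>
           f = (\<lambda>v. scale c1 (e1 v) + scale c2 (e2 v) + scale c3 (e3 v))"
proof -
  interpret endomorphisms scale using assms(1) by (rule endomorphisms.intro)
  obtain a b m B where "splitting scale f a b m" and B: "independent B" "range a = span B"
    and eig: "\<And>v. m v \<noteq> 0 \<Longrightarrow> \<exists>l. m (f v) = scale l (m v)"
    by (rule splitting_exists[OF assms(2)]) (rule that)
  interpret splitting scale f a b m by fact
  show ?thesis
    using three_idempotents_if_maximal[OF B eig] unfolding three_idempotents_def .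
qed

end
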